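(* Let $q\colon E\to M$ be a tangent display map in a tangent category $(\mathbb X,\mathbb T)$ and let $\phi\colon TE\to TE$ be a morphism. The following are equivalent: (1) $\phi$ is a split abstract vertical connection on $q$; (2) there is a full vertical connection $R$ on $q$ whose vertical connection form is $\phi$, i.e. $R\iota_q=\phi$; (3) there is a vertical connection $R$ on $q$ which is the vertical component of an Ehresmann connection $(R,H)$ on $q$ and whose vertical connection form is $\phi$, i.e. $R\iota_q=\phi$.
   Context: Composition is diagrammatic: $fg$ is $f$ followed by $g$; $\langle f,g\rangle$ denotes pairing into a (fibred) product, with projections $\pi_1,\pi_2$. A tangent category $(\mathbb X,\mathbb T)$ is a category $\mathbb X$ with an endofunctor $T$ and natural transformations $p_M\colon TM\to M$, $z_M\colon M\to TM$, $s_M\colon T_2M\to TM$, $l_M\colon TM\to T^2M$, $c_M\colon T^2M\to T^2M$, where the $n$-fold pullback $T_nM$ of $p_M$ along itself exists and is preserved by all $T^m$, such that: $(p_M,z_M,s_M)$ is an additive bundle (a commutative monoid in the category over $M$); $(z_M,l_M)\colon p_M\to Tp_M$ and $(\mathrm{id}_{TM},c_M)\colon Tp_M\to p_{TM}$ are additive bundle morphisms (commutative squares preserving zero and sum); $c_Mc_M=\mathrm{id}$, $l_Mc_M=l_M$, $l_M\,Tl_M=l_M\,l_{TM}$, $Tc_M\,c_{TM}\,Tc_M=c_{TM}\,Tc_M\,c_{TM}$, $l_{TM}\,Tc_M\,c_{TM}=c_M\,Tl_M$; and, with $\xi_M=\langle\pi_1l_M,\pi_2z_{TM}\rangle\,Ts_M\colon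 T_2M\to T^2M$, the square $\xi_M\,Tp_M=\pi_1p_Mz_M$ is a tangent pullback. A tangent pullback is a pullback preserved by $T^m$ for all $m\ge0$. A tangent display map is a morphism $q\colon E\to M$ such that for all $n\ge0$ and all $f\colon N\to T^nM$ the pullback of $T^nq$ along $f$ exists and is a tangent pullback. A differential bundle $\mathbf q\colon E\to M$ consists of $q\colon E\to M$, $z_q\colon M\to E$, $s_q\colon E_2\to E$, $l_q\colon E\to TE$ ($E_n$ the $n$-fold pullback of $q$ along itself, required to exist and be preserved by all $T^m$) such that $(q,z_q,s_q)$ is an additive bundle, $(z_M,l_q)\colon q\to Tq$ and $(z_q,l_q)\colon q\to p_E$ are additive bundle morphisms, $l_ql_E=l_q\,Tl_q$, and with $\xi_q=\langle\pi_1l_q,\pi_2z_E\rangle\,Ts_q\colon E_2\to TE$ the square $\xi_q\,Tq=\pi_1qz_M$ is a tangent pullback. Convention: all differential bundles are assumed display, i.e. $q$ is a tangent display map. A morphism $(f,g)\colon\mathbf q\to\mathbf q'$ (with $qf=gq'$) is linear if $g\,l_{q'}=l_q\,Tg$. $\mathsf{DB}(E)$ is the category of differential bundles over $E$ and linear morphisms over $\mathrm{id}_E$. $\mathbf p_E=(p_E,z_E,s_E,l_E)$ is the tangent bundle. For a tangent display map $q\colon E\to M$: the vertical bundle $\mathbf q^V\colon Vq\to E$ is given by the tangent pullback $Vq$ of $Tq$ along $z_M$, with projections $\iota_q\colon Vq\to TE$ and $T^Vq\colon Vq\to M$; $q^V=\iota_qp_E$, and its zero $z_q^V$, sum $s^V_q$,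 lift $l_q^V$ are determined by $z_q^V\iota_q=z_E$, $s_q^V\iota_q=(\iota_q\times\iota_q)s_E$, $l_q^V\,T\iota_q=\iota_ql_E$. The Finsler bundle $\mathbf q^F\colon Fq\to E$ is given by the tangent pullback $Fq$ of $q$ along $p_M$, with projections $q^F\colon Fq\to E$ and $T^Fq\colon Fq\to TM$, its zero $z_q^F$, sum $s_q^F$, lift $l_q^F$ determined by $z_q^Fq^F=\mathrm{id}_E$, $z_q^F\,T^Fq=qz_M$; $s_q^Fq^F=\pi_1q^F$, $s_q^F\,T^Fq=(T^Fq\times T^Fq)s_M$; $l_q^F\,Tq^F=q^Fz_E$, $l_q^F\,T(T^Fq)=T^Fq\,l_M$. The horizontal descent $\pi_q\colon TE\to Fq$ is the unique morphism with $\pi_qq^F=p_E$ and $\pi_q\,T^Fq=Tq$. A vertical connection on $q$ is $R\colon TE\to Vq$ with $\iota_qR=\mathrm{id}_{Vq}$ and $R\colon\mathbf p_E\to\mathbf q^V$ linear over $E$ ($Rq^V=p_E$, $Rl_q^V=l_E\,TR$); its vertical connection form is $R\iota_q\colon TE\to TE$. It is full if the commutative square $R\,T^Vq=Tq\,p_M$ (exhibiting $TE$ over $Vq\to M\leftarrow TM$ via $T^Vq$ and $p_M$) is a tangent pullback in $(\mathbb X,\mathbb T)$. A horizontal connection on $q$ is $H\colon Fq\to TE$ with $H\pi_q=\mathrm{id}_{Fq}$ and $H\colon\mathbf q^F\to\mathbf p_E$ linear over $E$ ($Hp_E=q^F$, $Hl_E=l_q^F\,TH$). An Ehresmann connection on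 $q$ is a pair $(R,H)$ of a vertical connection (its vertical component) and a horizontal connection with $HR=q^Fz_q^V$ and $\langle R\iota_q,\pi_qH\rangle s_E=\mathrm{id}_{TE}$. An abstract vertical connection on a morphism $q\colon E\to M$ is a morphism $\phi\colon TE\to TE$ such that: $\phi\phi=\phi$; $\phi\colon\mathbf p_E\to\mathbf p_E$ is linear over $E$ ($\phi p_E=p_E$, $\phi l_E=l_E\,T\phi$); and the square $\phi\,Tq=Tq\,p_Mz_M$ (with top $\phi\colon TE\to TE$, both vertical sides $Tq$, bottom $p_Mz_M\colon TM\to TM$) commutes and is a tangent pullback. It is split if the idempotent $\phi$ on $\mathbf p_E$ splits in $\mathsf{DB}(E)$, i.e. there are a differential bundle $\mathbf r$ over $E$ and linear morphisms over $E$, $\iota\colon\mathbf r\to\mathbf p_E$ and $\rho\colon\mathbf p_E\to\mathbf r$, with $\iota\rho=\mathrm{id}$ and $\rho\iota=\phi$. *)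

theory Defs
  imports Main
begin

section \<open>Categories and pullbacks\<close>

text \<open>Composition is diagrammatic: \<open>f \<cdot> g\<close> is \<open>f\<close> followed by \<open>g\<close>. It is only
  meaningful for composable arrows.\<close>

record ('o, 'm) category_data =
  Obj :: "'o set"
  Arr :: "'m set"
  Dom :: "'m \<Rightarrow> 'o"
  Cod :: "'m \<Rightarrow> 'o"
  Ident :: "'o \<Rightarrow> 'm"
  Comp :: "'m \<Rightarrow> 'm \<Rightarrow> 'm" (infixl "\<cdot>\<index>" 70)

definition hom :: "('o, 'm, 'x) category_data_scheme \<Rightarrow> 'o \<Rightarrow> 'o \<Rightarrow> 'm set" where
  "hom X A B = {f \<in> Arr X. Dom X f = A \<and> Cod X f = B}"

locale category =
  fixes X :: "('o, 'm, 'x) category_data_scheme" (structure)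
  assumes dom_obj: "f \<in> Arr X \<Longrightarrow> Dom X f \<in> Obj X"
    and cod_obj: "f \<in> Arr X \<Longrightarrow> Cod X f \<in> Obj X"
    and ident_hom: "A \<in> Obj X \<Longrightarrow> Ident X A \<in> hom X A A"
    and comp_hom: "f \<in> hom X A B \<Longrightarrow> g \<in> hom X B C \<Longrightarrow> f \<cdot> g \<in> hom X A C"
    and ident_comp: "f \<in> hom X A B \<Longrightarrow> Ident X A \<cdot> f = f"
    and comp_ident: "f \<in> hom X A B \<Longrightarrow> f \<cdot> Ident X B = f"
    and comp_assoc: "f \<in> hom X A B \<Longrightarrow> g \<in> hom X B C \<Longrightarrow> h \<in> hom X C D
      \<Longrightarrow> (f \<cdot> g) \<cdot> h = f \<cdot> (g \<cdot> h)"

text \<open>\<open>is_pullback X a b f g\<close>: the square \<open>a \<cdot> f = b \<cdot> g\<close> is a pullback, i.e. the cone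
  \<open>(a, b)\<close> is universal over the cospan \<open>(f, g)\<close>.\<close>

definition is_pullback ::
  "('o, 'm, 'x) category_data_scheme \<Rightarrow> 'm \<Rightarrow> 'm \<Rightarrow> 'm \<Rightarrow> 'm \<Rightarrow> bool" where
  "is_pullback X a b f g \<longleftrightarrow>
     a \<in> Arr X \<and> b \<in> Arr X \<and> f \<in> Arr X \<and> g \<in> Arr X \<and>
     Dom X a = Dom X b \<and> Cod X a = Dom X f \<and> Cod X b = Dom X g \<and> Cod X f = Cod X g \<and>
     a \<cdot> f = b \<cdot> g \<and>
     (\<forall>Q u v. u \<in> hom X Q (Cod X a) \<and> v \<in> hom X Q (Cod X b) \<and> u \<cdot> f = v \<cdot> g \<longrightarrow>
        (\<exists>!w. w \<in> hom X Q (Dom X a) \<and> w \<cdot> a = u \<and> w \<cdot> b = v))"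
  for X (structure)

text \<open>The pairing \<open>\<langle>u, v\<rangle>\<close> into a pullback with projections \<open>a\<close> and \<open>b\<close>.\<close>

definition pair ::
  "('o, 'm, 'x) category_data_scheme \<Rightarrow> 'm \<Rightarrow> 'm \<Rightarrow> 'm \<Rightarrow> 'm \<Rightarrow> 'm" where
  "pair X a b u v = (THE w. w \<in> hom X (Dom X u) (Dom X a) \<and> w \<cdot> a = u \<and> w \<cdot> b = v)"
  for X (structure)

text \<open>\<open>is_fibre_power X q n h \<pi>\<close>: the arrows \<open>\<pi> i\<close> (\<open>i < n\<close>) exhibit the domain of \<open>h\<close> as the
  \<open>n\<close>-fold pullback of \<open>q\<close> along itself, with \<open>h\<close> the induced arrow to the codomain of \<open>q\<close>;
  carrying \<open>h\<close> along makes \<open>n = 0\<close> (where the power is the codomain itself) come out right.\<close>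

definition is_fibre_power ::
  "('o, 'm, 'x) category_data_scheme \<Rightarrow> 'm \<Rightarrow> nat \<Rightarrow> 'm \<Rightarrow> (nat \<Rightarrow> 'm) \<Rightarrow> bool" where
  "is_fibre_power X q n h \<pi> \<longleftrightarrow>
     q \<in> Arr X \<and> h \<in> Arr X \<and> Cod X h = Cod X q \<and>
     (\<forall>i<n. \<pi> i \<in> hom X (Dom X h) (Dom X q) \<and> \<pi> i \<cdot> q = h) \<and>
     (\<forall>Q k u. k \<in> hom X Q (Cod X q) \<and> (\<forall>i<n. u i \<in> hom X Q (Dom X q) \<and> u i \<cdot> q = k) \<longrightarrow>
        (\<exists>!w. w \<in> hom X Q (Dom X h) \<and> w \<cdot> h = k \<and> (\<forall>i<n. w \<cdot> \<pi> i = u i)))"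
  for X (structure)


section \<open>Tangent pullbacks and bundle data\<close>

text \<open>\<open>Tob\<close> and \<open>Tar\<close> are the two parts of the endofunctor \<open>T\<close>. For each object \<open>M\<close>, \<open>tpr1 M\<close> and
  \<open>tpr2 M\<close> are the projections of a chosen pullback \<open>T\<^sub>2 M\<close> of \<open>tp M\<close> along itself, the domain
  of the sum \<open>ts M\<close>.\<close>

record ('o, 'm) tangent_data = "('o, 'm) category_data" +
  Tob :: "'o \<Rightarrow> 'o"
  Tar :: "'m \<Rightarrow> 'm"
  tp :: "'o \<Rightarrow> 'm"
  tz :: "'o \<Rightarrow> 'm"
  ts :: "'o \<Rightarrow> 'm"
  tl :: "'o \<Rightarrow> 'm"
  tc :: "'o \<Rightarrow> 'm"
  tpr1 :: "'o \<Rightarrow> 'm"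
  tpr2 :: "'o \<Rightarrow> 'm"

definition tangent_pullback ::
  "('o, 'm, 'x) tangent_data_scheme \<Rightarrow> 'm \<Rightarrow> 'm \<Rightarrow> 'm \<Rightarrow> 'm \<Rightarrow> bool" where
  "tangent_pullback X a b f g \<longleftrightarrow>
     (\<forall>m. is_pullback X ((Tar X ^^ m) a) ((Tar X ^^ m) b) ((Tar X ^^ m) f) ((Tar X ^^ m) g))"

definition has_tangent_fibre_powers :: "('o, 'm, 'x) tangent_data_scheme \<Rightarrow> 'm \<Rightarrow> bool" where
  "has_tangent_fibre_powers X q \<longleftrightarrow>
     (\<forall>n. \<exists>h \<pi>. \<forall>m.
        is_fibre_power X ((Tar X ^^ m) q) n ((Tar X ^^ m) h) (\<lambda>i. (Tar X ^^ m) (\<pi> i)))"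

text \<open>Data of an additive bundle: projection \<open>q : E \<rightarrow> M\<close>, zero \<open>M \<rightarrow> E\<close>, sum \<open>E\<^sub>2 \<rightarrow> E\<close>, and the
  projections of a chosen pullback \<open>E\<^sub>2\<close> of \<open>q\<close> along itself. A differential bundle adds a lift
  \<open>E \<rightarrow> TE\<close>.\<close>

record 'm additive_data =
  proj :: 'm
  zero :: 'm
  plus :: 'm
  pr1 :: 'm
  pr2 :: 'm

record 'm bundle_data = "'m additive_data" +
  lift :: 'm

text \<open>\<open>bsum X B u v\<close> is \<open>\<langle>u, v\<rangle> s\<^sub>q\<close>, the sum of \<open>u, v : Q \<rightarrow> E\<close> with \<open>u q = v q\<close>.\<close>

definition bsum ::
  "('o, 'm, 'x) category_data_scheme \<Rightarrow> ('m, 'b) additive_data_scheme \<Rightarrow> 'm \<Rightarrow> 'm \<Rightarrow> 'm" where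
  "bsum X B u v = pair X (pr1 B) (pr2 B) u v \<cdot> plus B"
  for X (structure)

text \<open>Commutative monoids in the category over \<open>M\<close>; the monoid laws are written with generalized
  elements \<open>u, v, w : Q \<rightarrow> E\<close> over \<open>M\<close>.\<close>

definition additive_bundle ::
  "('o, 'm, 'x) category_data_scheme \<Rightarrow> ('m, 'b) additive_data_scheme \<Rightarrow> bool" where
  "additive_bundle X B \<longleftrightarrow>
     (let q = proj B; E = Dom X q; M = Cod X q in
      is_pullback X (pr1 B) (pr2 B) q q \<and>
      zero B \<in> hom X M E \<and> zero B \<cdot> q = Ident X M \<and>
      plus B \<in> hom X (Dom X (pr1 B)) E \<and> plus B \<cdot> q = pr1 B \<cdot> q \<and>
      (\<forall>Q u v w. u \<in> hom X Q E \<and> v \<in> hom X Q E \<and> w \<in> hom X Q E \<and>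
         u \<cdot> q = v \<cdot> q \<and> v \<cdot> q = w \<cdot> q \<longrightarrow>
           bsum X B (bsum X B u v) w = bsum X B u (bsum X B v w)) \<and>
      (\<forall>Q u v. u \<in> hom X Q E \<and> v \<in> hom X Q E \<and> u \<cdot> q = v \<cdot> q \<longrightarrow>
         bsum X B u v = bsum X B v u) \<and>
      (\<forall>Q u. u \<in> hom X Q E \<longrightarrow> bsum X B u (u \<cdot> q \<cdot> zero B) = u))"
  for X (structure)

definition bundle_morphism :: "('o, 'm, 'x) category_data_scheme \<Rightarrow>
    ('m, 'b) additive_data_scheme \<Rightarrow> ('m, 'c) additive_data_scheme \<Rightarrow> 'm \<Rightarrow> 'm \<Rightarrow> bool" where
  "bundle_morphism X B B' f g \<longleftrightarrow>
     f \<in> hom X (Cod X (proj B)) (Cod X (proj B')) \<and>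
     g \<in> hom X (Dom X (proj B)) (Dom X (proj B')) \<and>
     proj B \<cdot> f = g \<cdot> proj B'"
  for X (structure)

definition additive_morphism :: "('o, 'm, 'x) category_data_scheme \<Rightarrow>
    ('m, 'b) additive_data_scheme \<Rightarrow> ('m, 'c) additive_data_scheme \<Rightarrow> 'm \<Rightarrow> 'm \<Rightarrow> bool" where
  "additive_morphism X B B' f g \<longleftrightarrow>
     bundle_morphism X B B' f g \<and>
     zero B \<cdot> g = f \<cdot> zero B' \<and>
     plus B \<cdot> g = bsum X B' (pr1 B \<cdot> g) (pr2 B \<cdot> g)"
  for X (structure)

text \<open>The image \<open>(Tq, Tz\<^sub>q, Ts\<^sub>q)\<close> of an additive bundle under \<open>T\<close>, with \<open>T(E\<^sub>2)\<close> as the chosen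
  pullback of \<open>Tq\<close> along itself.\<close>

definition T_additive ::
  "('o, 'm, 'x) tangent_data_scheme \<Rightarrow> ('m, 'b) additive_data_scheme \<Rightarrow> 'm additive_data" where
  "T_additive X B = \<lparr>proj = Tar X (proj B), zero = Tar X (zero B), plus = Tar X (plus B),
     pr1 = Tar X (pr1 B), pr2 = Tar X (pr2 B)\<rparr>"

definition tangent_bundle :: "('o, 'm, 'x) tangent_data_scheme \<Rightarrow> 'o \<Rightarrow> 'm bundle_data" where
  "tangent_bundle X M = \<lparr>proj = tp X M, zero = tz X M, plus = ts X M,
     pr1 = tpr1 X M, pr2 = tpr2 X M, lift = tl X M\<rparr>"

text \<open>\<open>\<xi>\<^sub>q = \<langle>\<pi>\<^sub>1 l\<^sub>q, \<pi>\<^sub>2 z\<^sub>E\<rangle> Ts\<^sub>q : E\<^sub>2 \<rightarrow> TE\<close>, the pairing being into \<open>T(E\<^sub>2)\<close>, and the universality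
  of the lift: the square \<open>\<xi>\<^sub>q Tq = \<pi>\<^sub>1 q z\<^sub>M\<close> is a tangent pullback.\<close>

definition lift_xi :: "('o, 'm, 'x) tangent_data_scheme \<Rightarrow> 'm bundle_data \<Rightarrow> 'm" where
  "lift_xi X B =
     bsum X (T_additive X B) (pr1 B \<cdot> lift B) (pr2 B \<cdot> tz X (Dom X (proj B)))"
  for X (structure)

definition universal_lift :: "('o, 'm, 'x) tangent_data_scheme \<Rightarrow> 'm bundle_data \<Rightarrow> bool" where
  "universal_lift X B \<longleftrightarrow>
     tangent_pullback X (lift_xi X B) (pr1 B \<cdot> proj B) (Tar X (proj B)) (tz X (Cod X (proj B)))"
  for X (structure)


section \<open>Tangent categories\<close>

locale tangent_category = category X
  for X :: "('o, 'm, 'x) tangent_data_scheme" (structure) +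
  assumes Tob_obj: "M \<in> Obj X \<Longrightarrow> Tob X M \<in> Obj X"
    and Tar_hom: "f \<in> hom X A B \<Longrightarrow> Tar X f \<in> hom X (Tob X A) (Tob X B)"
    and Tar_ident: "M \<in> Obj X \<Longrightarrow> Tar X (Ident X M) = Ident X (Tob X M)"
    and Tar_comp: "f \<in> hom X A B \<Longrightarrow> g \<in> hom X B C \<Longrightarrow> Tar X (f \<cdot> g) = Tar X f \<cdot> Tar X g"
    and tp_hom: "M \<in> Obj X \<Longrightarrow> tp X M \<in> hom X (Tob X M) M"
    and tz_hom: "M \<in> Obj X \<Longrightarrow> tz X M \<in> hom X M (Tob X M)"
    and ts_hom: "M \<in> Obj X \<Longrightarrow> ts X M \<in> hom X (Dom X (tpr1 X M)) (Tob X M)"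
    and tl_hom: "M \<in> Obj X \<Longrightarrow> tl X M \<in> hom X (Tob X M) (Tob X (Tob X M))"
    and tc_hom: "M \<in> Obj X \<Longrightarrow> tc X M \<in> hom X (Tob X (Tob X M)) (Tob X (Tob X M))"
    and tp_nat: "f \<in> hom X M N \<Longrightarrow> Tar X f \<cdot> tp X N = tp X M \<cdot> f"
    and tz_nat: "f \<in> hom X M N \<Longrightarrow> f \<cdot> tz X N = tz X M \<cdot> Tar X f"
    and ts_nat: "f \<in> hom X M N \<Longrightarrow>
      pair X (tpr1 X N) (tpr2 X N) (tpr1 X M \<cdot> Tar X f) (tpr2 X M \<cdot> Tar X f) \<cdot> ts X N
        = ts X M \<cdot> Tar X f"
    and tl_nat: "f \<in> hom X M N \<Longrightarrow> Tar X f \<cdot> tl X N = tl X M \<cdot> Tar X (Tar X f)"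
    and tc_nat: "f \<in> hom X M N \<Longrightarrow> Tar X (Tar X f) \<cdot> tc X N = tc X M \<cdot> Tar X (Tar X f)"
    and T2_pullback: "M \<in> Obj X \<Longrightarrow> tangent_pullback X (tpr1 X M) (tpr2 X M) (tp X M) (tp X M)"
    and tp_powers: "M \<in> Obj X \<Longrightarrow> has_tangent_fibre_powers X (tp X M)"
    and tp_additive: "M \<in> Obj X \<Longrightarrow> additive_bundle X (tangent_bundle X M)"
    and tl_additive: "M \<in> Obj X \<Longrightarrow>
      additive_morphism X (tangent_bundle X M) (T_additive X (tangent_bundle X M))
        (tz X M) (tl X M)"
    and tc_additive: "M \<in> Obj X \<Longrightarrow>
      additive_morphism X (T_additive X (tangent_bundle X M)) (tangent_bundle X (Tob X M))
        (Ident X (Tob X M)) (tc X M)"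
    and tc_tc: "M \<in> Obj X \<Longrightarrow> tc X M \<cdot> tc X M = Ident X (Tob X (Tob X M))"
    and tl_tc: "M \<in> Obj X \<Longrightarrow> tl X M \<cdot> tc X M = tl X M"
    and tl_tl: "M \<in> Obj X \<Longrightarrow> tl X M \<cdot> Tar X (tl X M) = tl X M \<cdot> tl X (Tob X M)"
    and tc_braid: "M \<in> Obj X \<Longrightarrow>
      Tar X (tc X M) \<cdot> tc X (Tob X M) \<cdot> Tar X (tc X M)
        = tc X (Tob X M) \<cdot> Tar X (tc X M) \<cdot> tc X (Tob X M)"
    and tl_tc_tc: "M \<in> Obj X \<Longrightarrow>
      tl X (Tob X M) \<cdot> Tar X (tc X M) \<cdot> tc X (Tob X M) = tc X M \<cdot> Tar X (tl X M)"
    and tl_universal: "M \<in> Obj X \<Longrightarrow> universal_lift X (tangent_bundle X M)"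


section \<open>Tangent display maps and differential bundles\<close>

definition tangent_display_map :: "('o, 'm, 'x) tangent_data_scheme \<Rightarrow> 'm \<Rightarrow> bool" where
  "tangent_display_map X q \<longleftrightarrow>
     q \<in> Arr X \<and>
     (\<forall>n f. f \<in> Arr X \<and> Cod X f = (Tob X ^^ n) (Cod X q) \<longrightarrow>
        (\<exists>a b. tangent_pullback X a b ((Tar X ^^ n) q) f))"

text \<open>Differential bundles are display by convention, so this is part of the definition.\<close>

definition differential_bundle :: "('o, 'm, 'x) tangent_data_scheme \<Rightarrow> 'm bundle_data \<Rightarrow> bool" where
  "differential_bundle X B \<longleftrightarrow>
     (let q = proj B; E = Dom X q; M = Cod X q in
      tangent_display_map X q \<and>
      has_tangent_fibre_powers X q \<and>
      tangent_pullback X (pr1 B) (pr2 B) q q \<and>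
      additive_bundle X B \<and>
      lift B \<in> hom X E (Tob X E) \<and>
      additive_morphism X B (T_additive X B) (tz X M) (lift B) \<and>
      additive_morphism X B (tangent_bundle X E) (zero B) (lift B) \<and>
      lift B \<cdot> tl X E = lift B \<cdot> Tar X (lift B) \<and>
      universal_lift X B)"
  for X (structure)

definition linear_morphism :: "('o, 'm, 'x) tangent_data_scheme \<Rightarrow>
    'm bundle_data \<Rightarrow> 'm bundle_data \<Rightarrow> 'm \<Rightarrow> 'm \<Rightarrow> bool" where
  "linear_morphism X B B' f g \<longleftrightarrow>
     bundle_morphism X B B' f g \<and> g \<cdot> lift B' = lift B \<cdot> Tar X g"
  for X (structure)

text \<open>Objects and morphisms of the category \<open>DB(E)\<close>.\<close>

definition DB :: "('o, 'm, 'x) tangent_data_scheme \<Rightarrow> 'o \<Rightarrow> 'm bundle_data set" where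
  "DB X E = {B. differential_bundle X B \<and> Cod X (proj B) = E}"

definition linear_over :: "('o, 'm, 'x) tangent_data_scheme \<Rightarrow> 'o \<Rightarrow>
    'm bundle_data \<Rightarrow> 'm bundle_data \<Rightarrow> 'm \<Rightarrow> bool" where
  "linear_over X E B B' g \<longleftrightarrow>
     Cod X (proj B) = E \<and> Cod X (proj B') = E \<and> linear_morphism X B B' (Ident X E) g"


section \<open>Vertical and Finsler bundles\<close>

text \<open>Both are determined by a choice of the pullbacks involved; the predicates below say that
  given data form a vertical (resp. Finsler) bundle of \<open>q : E \<rightarrow> M\<close>. For \<open>vertical_bundle X q V \<iota> t\<close>,
  \<open>\<iota>\<close> is \<open>\<iota>\<^sub>q : Vq \<rightarrow> TE\<close> and \<open>t\<close> is \<open>T\<^sup>Vq : Vq \<rightarrow> M\<close>; for \<open>finsler_bundle X q F t\<close>, the pullback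
  projections are \<open>q\<^sup>F = proj F : Fq \<rightarrow> E\<close> and \<open>t = T\<^sup>Fq : Fq \<rightarrow> TM\<close>.\<close>

definition vertical_bundle :: "('o, 'm, 'x) tangent_data_scheme \<Rightarrow> 'm \<Rightarrow>
    'm bundle_data \<Rightarrow> 'm \<Rightarrow> 'm \<Rightarrow> bool" where
  "vertical_bundle X q V \<iota> t \<longleftrightarrow>
     (let E = Dom X q; M = Cod X q; Vq = Dom X \<iota> in
      tangent_pullback X \<iota> t (Tar X q) (tz X M) \<and>
      proj V = \<iota> \<cdot> tp X E \<and>
      tangent_pullback X (pr1 V) (pr2 V) (proj V) (proj V) \<and>
      zero V \<in> hom X E Vq \<and> zero V \<cdot> \<iota> = tz X E \<and>
      plus V \<in> hom X (Dom X (pr1 V)) Vq \<and>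
      plus V \<cdot> \<iota> = bsum X (tangent_bundle X E) (pr1 V \<cdot> \<iota>) (pr2 V \<cdot> \<iota>) \<and>
      lift V \<in> hom X Vq (Tob X Vq) \<and> lift V \<cdot> Tar X \<iota> = \<iota> \<cdot> tl X E)"
  for X (structure)

definition finsler_bundle :: "('o, 'm, 'x) tangent_data_scheme \<Rightarrow> 'm \<Rightarrow>
    'm bundle_data \<Rightarrow> 'm \<Rightarrow> bool" where
  "finsler_bundle X q F t \<longleftrightarrow>
     (let E = Dom X q; M = Cod X q; Fq = Dom X t in
      tangent_pullback X (proj F) t q (tp X M) \<and>
      tangent_pullback X (pr1 F) (pr2 F) (proj F) (proj F) \<and>
      zero F \<in> hom X E Fq \<and>
      zero F \<cdot> proj F = Ident X E \<and> zero F \<cdot> t = q \<cdot> tz X M \<and>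
      plus F \<in> hom X (Dom X (pr1 F)) Fq \<and>
      plus F \<cdot> proj F = pr1 F \<cdot> proj F \<and>
      plus F \<cdot> t = bsum X (tangent_bundle X M) (pr1 F \<cdot> t) (pr2 F \<cdot> t) \<and>
      lift F \<in> hom X Fq (Tob X Fq) \<and>
      lift F \<cdot> Tar X (proj F) = proj F \<cdot> tz X E \<and>
      lift F \<cdot> Tar X t = t \<cdot> tl X M)"
  for X (structure)

text \<open>The horizontal descent \<open>\<pi>\<^sub>q : TE \<rightarrow> Fq\<close>.\<close>

definition horizontal_descent ::
  "('o, 'm, 'x) tangent_data_scheme \<Rightarrow> 'm \<Rightarrow> 'm bundle_data \<Rightarrow> 'm \<Rightarrow> 'm" where
  "horizontal_descent X q F t = pair X (proj F) t (tp X (Dom X q)) (Tar X q)"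


section \<open>Connections\<close>

text \<open>In this section \<open>V, \<iota>, tV\<close> are a vertical bundle and \<open>F, tF\<close> a Finsler bundle of \<open>q\<close>.\<close>

definition vertical_connection :: "('o, 'm, 'x) tangent_data_scheme \<Rightarrow> 'm \<Rightarrow>
    'm bundle_data \<Rightarrow> 'm \<Rightarrow> 'm \<Rightarrow> bool" where
  "vertical_connection X q V \<iota> R \<longleftrightarrow>
     R \<in> hom X (Tob X (Dom X q)) (Dom X \<iota>) \<and>
     \<iota> \<cdot> R = Ident X (Dom X \<iota>) \<and>
     linear_over X (Dom X q) (tangent_bundle X (Dom X q)) V R"
  for X (structure)

definition vertical_connection_form ::
  "('o, 'm, 'x) tangent_data_scheme \<Rightarrow> 'm \<Rightarrow> 'm \<Rightarrow> 'm" where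
  "vertical_connection_form X \<iota> R = R \<cdot> \<iota>"
  for X (structure)

definition full_vertical_connection :: "('o, 'm, 'x) tangent_data_scheme \<Rightarrow> 'm \<Rightarrow>
    'm bundle_data \<Rightarrow> 'm \<Rightarrow> 'm \<Rightarrow> 'm \<Rightarrow> bool" where
  "full_vertical_connection X q V \<iota> tV R \<longleftrightarrow>
     vertical_connection X q V \<iota> R \<and>
     tangent_pullback X R (Tar X q) tV (tp X (Cod X q))"

definition horizontal_connection :: "('o, 'm, 'x) tangent_data_scheme \<Rightarrow> 'm \<Rightarrow>
    'm bundle_data \<Rightarrow> 'm \<Rightarrow> 'm \<Rightarrow> bool" where
  "horizontal_connection X q F tF H \<longleftrightarrow>
     H \<in> hom X (Dom X tF) (Tob X (Dom X q)) \<and>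
     H \<cdot> horizontal_descent X q F tF = Ident X (Dom X tF) \<and>
     linear_over X (Dom X q) F (tangent_bundle X (Dom X q)) H"
  for X (structure)

definition ehresmann_connection :: "('o, 'm, 'x) tangent_data_scheme \<Rightarrow> 'm \<Rightarrow>
    'm bundle_data \<Rightarrow> 'm \<Rightarrow> 'm bundle_data \<Rightarrow> 'm \<Rightarrow> 'm \<Rightarrow> 'm \<Rightarrow> bool" where
  "ehresmann_connection X q V \<iota> F tF R H \<longleftrightarrow>
     vertical_connection X q V \<iota> R \<and>
     horizontal_connection X q F tF H \<and>
     H \<cdot> R = proj F \<cdot> zero V \<and>
     bsum X (tangent_bundle X (Dom X q)) (R \<cdot> \<iota>) (horizontal_descent X q F tF \<cdot> H)
       = Ident X (Tob X (Dom X q))"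
  for X (structure)

definition abstract_vertical_connection ::
  "('o, 'm, 'x) tangent_data_scheme \<Rightarrow> 'm \<Rightarrow> 'm \<Rightarrow> bool" where
  "abstract_vertical_connection X q \<phi> \<longleftrightarrow>
     (let E = Dom X q; M = Cod X q in
      \<phi> \<in> hom X (Tob X E) (Tob X E) \<and>
      \<phi> \<cdot> \<phi> = \<phi> \<and>
      linear_over X E (tangent_bundle X E) (tangent_bundle X E) \<phi> \<and>
      tangent_pullback X \<phi> (Tar X q) (Tar X q) (tp X M \<cdot> tz X M))"
  for X (structure)

definition splits_in_DB :: "('o, 'm, 'x) tangent_data_scheme \<Rightarrow> 'o \<Rightarrow> 'm \<Rightarrow> bool" where
  "splits_in_DB X E \<phi> \<longleftrightarrow>
     (\<exists>r \<iota> \<rho>. r \<in> DB X E \<and>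
        linear_over X E r (tangent_bundle X E) \<iota> \<and>
        linear_over X E (tangent_bundle X E) r \<rho> \<and>
        \<iota> \<cdot> \<rho> = Ident X (Dom X (proj r)) \<and> \<rho> \<cdot> \<iota> = \<phi>)"
  for X (structure)

definition split_abstract_vertical_connection ::
  "('o, 'm, 'x) tangent_data_scheme \<Rightarrow> 'm \<Rightarrow> 'm \<Rightarrow> bool" where
  "split_abstract_vertical_connection X q \<phi> \<longleftrightarrow>
     abstract_vertical_connection X q \<phi> \<and> splits_in_DB X (Dom X q) \<phi>"

end

theory Submission
  imports Defs
begin

text \<open>The first equivalence is pasting of squares. The square \<open>\<iota>\<^sub>q Tq = T\<^sup>Vq z\<^sub>M\<close> that defines
  \<open>Vq\<close> is a tangent pullback; put next to the square \<open>R T\<^sup>Vq = Tq p\<^sub>M\<close> of a vertical connection it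
  gives the square \<open>(R \<iota>\<^sub>q) Tq = Tq p\<^sub>M z\<^sub>M\<close>. Hence \<open>R\<close> is full exactly if the square of its
  connection form is a tangent pullback (\<open>full_vertical_connection_iff\<close>). An abstract vertical
  connection \<open>\<phi>\<close> satisfies \<open>\<phi> Tq = Tq p\<^sub>M z\<^sub>M\<close>, so it factors as \<open>R \<iota>\<^sub>q\<close>, and the universal property
  of its square yields \<open>\<iota>\<^sub>q \<phi> = \<iota>\<^sub>q\<close>; since \<open>\<iota>\<^sub>q\<close> is monic, \<open>R\<close> is a retraction of \<open>\<iota>\<^sub>q\<close> and inherits
  linearity from \<open>\<phi>\<close>. Conversely \<open>R \<iota>\<^sub>q\<close> is a linear idempotent which splits through the vertical
  bundle. For this the vertical bundle must be a differential bundle (\<open>V_in_DB\<close>), which takes most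
  of the work. All its equations hold because \<open>\<iota>\<^sub>q\<close> and its images under \<open>T\<close> are monic and carry
  them to equations of the tangent bundle of \<open>E\<close>; the universality of its lift is \<open>V_universal\<close>.

  For the second equivalence, if \<open>TE\<close> is the pullback of \<open>Vq\<close> and \<open>TM\<close> over \<open>M\<close>, then \<open>H\<close> is the
  arrow with coordinates \<open>q\<^sup>F z\<^sub>q\<^sup>V\<close> and \<open>T\<^sup>Fq\<close>, and each condition on \<open>H\<close> is checked in coordinates.
  Conversely, given \<open>(R, H)\<close>, the arrow with coordinates \<open>u\<close> and \<open>v\<close> is the sum of \<open>u \<iota>\<^sub>q\<close> and the
  horizontal lift of \<open>v\<close>, and it is unique because every tangent vector is the sum of its vertical
  and its horizontal part. Both directions use that \<open>R\<close> preserves sums, which follows from its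
  linearity (\<open>linear_imp_additive\<close>).

  Preservation by the powers of \<open>T\<close> is dealt with once: a pullback over a cospan that has some
  tangent pullback is itself tangent (\<open>tangent_pullback_unique\<close>), and the maps in question are
  tangent display maps.\<close>

section \<open>Arrows and pullbacks in a category\<close>

context category
begin

lemma hom_iff: "f \<in> hom X A B \<longleftrightarrow> f \<in> Arr X \<and> Dom X f = A \<and> Cod X f = B"
  by (simp add: hom_def)

lemma dom_cod_obj [simp]:
  "f \<in> Arr X \<Longrightarrow> Dom X f \<in> Obj X" "f \<in> Arr X \<Longrightarrow> Cod X f \<in> Obj X"
  by (rule dom_obj cod_obj, assumption)+

lemma ident_typing [simp]:
  assumes "A \<in> Obj X"
  shows "Ident X A \<in> Arr X" "Dom X (Ident X A) = A" "Cod X (Ident X A) = A"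
  using ident_hom[OF assms] by (simp_all add: hom_iff)

lemma comp_typing [simp]:
  assumes "f \<in> Arr X" "g \<in> Arr X" "Cod X f = Dom X g"
  shows "f \<cdot> g \<in> Arr X" "Dom X (f \<cdot> g) = Dom X f" "Cod X (f \<cdot> g) = Cod X g"
  using comp_hom[of f "Dom X f" "Dom X g" g "Cod X g"] assms by (simp_all add: hom_iff)

lemma ident_left [simp]: "f \<in> Arr X \<Longrightarrow> Dom X f = A \<Longrightarrow> Ident X A \<cdot> f = f"
  using ident_comp[of f A "Cod X f"] by (simp add: hom_iff)

lemma ident_right [simp]: "f \<in> Arr X \<Longrightarrow> Cod X f = A \<Longrightarrow> f \<cdot> Ident X A = f"
  using comp_ident[of f "Dom X f" A] by (simp add: hom_iff)

lemma assoc [simp]: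
  assumes "f \<in> Arr X" "g \<in> Arr X" "h \<in> Arr X" "Cod X f = Dom X g" "Cod X g = Dom X h"
  shows "(f \<cdot> g) \<cdot> h = f \<cdot> (g \<cdot> h)"
  using comp_assoc[of f "Dom X f" "Dom X g" g "Dom X h" h "Cod X h"] assms
  by (simp add: hom_iff)

text \<open>Composites are normalised to the right, so an equation between two composites can only be
  used inside a longer composite after it has been extended by the tail.\<close>

lemma extend_right:
  assumes "f \<cdot> g = h" "f \<in> Arr X" "g \<in> Arr X" "k \<in> Arr X"
    and "Cod X f = Dom X g" "Cod X g = Dom X k"
  shows "f \<cdot> (g \<cdot> k) = h \<cdot> k"
  using assms by (metis assoc)

lemma is_pullbackD:
  assumes "is_pullback X a b f g"
  shows "a \<in> Arr X" "b \<in> Arr X" "f \<in> Arr X" "g \<in> Arr X" "Dom X b = Dom X a"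
    "Cod X a = Dom X f" "Cod X b = Dom X g" "Cod X g = Cod X f" "a \<cdot> f = b \<cdot> g"
  using assms by (auto simp: is_pullback_def)

lemma pullback_ext:
  assumes "is_pullback X a b f g" "w \<in> Arr X" "w' \<in> Arr X" "Dom X w = Dom X w'"
    "Cod X w = Dom X a" "Cod X w' = Dom X a" "w \<cdot> a = w' \<cdot> a" "w \<cdot> b = w' \<cdot> b"
  shows "w = w'"
proof -
  note pb = is_pullbackD[OF assms(1)]
  have "w \<cdot> a \<in> hom X (Dom X w) (Cod X a)" "w \<cdot> b \<in> hom X (Dom X w) (Cod X b)"
    using assms pb by (simp_all add: hom_iff)
  moreover have "(w \<cdot> a) \<cdot> f = (w \<cdot> b) \<cdot> g"
    using assms pb by simp
  ultimately have "\<exists>!x. x \<in> hom X (Dom X w) (Dom X a) \<and> x \<cdot> a = w \<cdot> a \<and> x \<cdot> b = w \<cdot> b"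
    using assms(1) unfolding is_pullback_def by blast
  then show ?thesis
    using assms by (auto simp: hom_iff)
qed

lemma pair:
  assumes "is_pullback X a b f g" "u \<in> Arr X" "v \<in> Arr X" "Dom X v = Dom X u"
    "Cod X u = Dom X f" "Cod X v = Dom X g" "u \<cdot> f = v \<cdot> g"
  shows "pair X a b u v \<in> Arr X" "Dom X (pair X a b u v) = Dom X u"
    "Cod X (pair X a b u v) = Dom X a" "pair X a b u v \<cdot> a = u" "pair X a b u v \<cdot> b = v"
proof -
  note pb = is_pullbackD[OF assms(1)]
  have "u \<in> hom X (Dom X u) (Cod X a)" "v \<in> hom X (Dom X u) (Cod X b)"
    using assms pb by (simp_all add: hom_iff)
  then have "\<exists>!w. w \<in> hom X (Dom X u) (Dom X a) \<and> w \<cdot> a = u \<and> w \<cdot> b = v"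
    using assms(1,7) unfolding is_pullback_def by blast
  from theI'[OF this] show "pair X a b u v \<in> Arr X" "Dom X (pair X a b u v) = Dom X u"
    "Cod X (pair X a b u v) = Dom X a" "pair X a b u v \<cdot> a = u" "pair X a b u v \<cdot> b = v"
    by (auto simp: pair_def hom_iff)
qed

lemma pair_eqI:
  assumes "is_pullback X a b f g" "w \<in> Arr X" "Cod X w = Dom X a" "w \<cdot> a = u" "w \<cdot> b = v"
  shows "pair X a b u v = w"
proof -
  note pb = is_pullbackD[OF assms(1)]
  have t: "u \<in> Arr X" "v \<in> Arr X" "Dom X u = Dom X w" "Dom X v = Dom X w"
    "Cod X u = Dom X f" "Cod X v = Dom X g" "u \<cdot> f = v \<cdot> g"
    using assms pb by (auto simp flip: assms(4,5))
  then have d: "Dom X v = Dom X u" by simp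
  note p = pair[OF assms(1) t(1,2) d t(5-7)]
  show ?thesis
    by (rule pullback_ext[OF assms(1)]) (use p assms t in simp_all)
qed

lemma comp_pair:
  assumes "is_pullback X a b f g" "u \<in> Arr X" "v \<in> Arr X" "Dom X v = Dom X u"
    "Cod X u = Dom X f" "Cod X v = Dom X g" "u \<cdot> f = v \<cdot> g" "k \<in> Arr X" "Cod X k = Dom X u"
  shows "k \<cdot> pair X a b u v = pair X a b (k \<cdot> u) (k \<cdot> v)"
proof -
  note pb = is_pullbackD[OF assms(1)]
  note p = pair[OF assms(1-7)]
  show ?thesis
    by (rule pair_eqI[symmetric, OF assms(1)]) (use p assms pb in simp_all)
qed

lemma is_pullbackI:
  assumes "a \<in> Arr X" "b \<in> Arr X" "f \<in> Arr X" "g \<in> Arr X" "Dom X b = Dom X a"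
    "Cod X a = Dom X f" "Cod X b = Dom X g" "Cod X g = Cod X f" "a \<cdot> f = b \<cdot> g"
    and ex: "\<And>u v. u \<in> Arr X \<Longrightarrow> v \<in> Arr X \<Longrightarrow> Dom X v = Dom X u \<Longrightarrow>
      Cod X u = Dom X f \<Longrightarrow> Cod X v = Dom X g \<Longrightarrow> u \<cdot> f = v \<cdot> g \<Longrightarrow>
      \<exists>w. w \<in> Arr X \<and> Dom X w = Dom X u \<and> Cod X w = Dom X a \<and> w \<cdot> a = u \<and> w \<cdot> b = v"
    and uniq: "\<And>w w'. w \<in> Arr X \<Longrightarrow> w' \<in> Arr X \<Longrightarrow> Dom X w = Dom X w' \<Longrightarrow>
      Cod X w = Dom X a \<Longrightarrow> Cod X w' = Dom X a \<Longrightarrow> w \<cdot> a = w' \<cdot> a \<Longrightarrow> w \<cdot> b = w' \<cdot> b \<Longrightarrow> w = w'"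
  shows "is_pullback X a b f g"
  unfolding is_pullback_def
proof (intro conjI allI impI ex_ex1I)
  fix Q u v
  assume "u \<in> hom X Q (Cod X a) \<and> v \<in> hom X Q (Cod X b) \<and> u \<cdot> f = v \<cdot> g"
  then show "\<exists>w. w \<in> hom X Q (Dom X a) \<and> w \<cdot> a = u \<and> w \<cdot> b = v"
    using ex[of u v] assms(6,7) by (auto simp: hom_iff)
next
  fix Q u v w w'
  assume "w \<in> hom X Q (Dom X a) \<and> w \<cdot> a = u \<and> w \<cdot> b = v"
    "w' \<in> hom X Q (Dom X a) \<and> w' \<cdot> a = u \<and> w' \<cdot> b = v"
  then show "w = w'"
    using uniq[of w w'] by (auto simp: hom_iff)
qed (use assms(1-9) in simp_all)

definition monic :: "'m \<Rightarrow> bool" where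
  "monic m \<longleftrightarrow> m \<in> Arr X \<and>
     (\<forall>u v. u \<in> Arr X \<and> v \<in> Arr X \<and> Dom X u = Dom X v \<and> Cod X u = Dom X m \<and> Cod X v = Dom X m \<and>
        u \<cdot> m = v \<cdot> m \<longrightarrow> u = v)"

lemma monicD:
  assumes "monic m" "u \<cdot> m = v \<cdot> m" "u \<in> Arr X" "v \<in> Arr X" "Dom X u = Dom X v"
    "Cod X u = Dom X m" "Cod X v = Dom X m"
  shows "u = v"
  using assms unfolding monic_def by blast

lemma pullback_monic:
  assumes "is_pullback X a b f g" "b = a \<cdot> c" "c \<in> Arr X" "Dom X c = Cod X a"
  shows "monic a"
  unfolding monic_def
proof (intro conjI allI impI; (elim conjE)?)
  note pb = is_pullbackD[OF assms(1)]
  show "a \<in> Arr X" by (fact pb)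
  fix u v
  assume uv: "u \<in> Arr X" "v \<in> Arr X" "Dom X u = Dom X v" "Cod X u = Dom X a" "Cod X v = Dom X a"
    "u \<cdot> a = v \<cdot> a"
  have "u \<cdot> b = v \<cdot> b"
    using extend_right[OF uv(6), of c] uv pb(1) assms by simp
  then show "u = v"
    using pullback_ext[OF assms(1) uv(1-6)] by simp
qed

text \<open>The pasting law for the squares \<open>r t = b p\<close> and \<open>i f = t z\<close>, the second a pullback.\<close>

lemma pullback_paste_iff:
  assumes "is_pullback X i t f z"
    and "r \<in> Arr X" "b \<in> Arr X" "p \<in> Arr X" "Dom X r = Dom X b" "Cod X r = Dom X i"
    "Cod X b = Dom X p" "Cod X p = Dom X z" "r \<cdot> t = b \<cdot> p"
  shows "is_pullback X r b t p \<longleftrightarrow> is_pullback X (r \<cdot> i) b f (p \<cdot> z)"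
proof
  note pb = is_pullbackD[OF assms(1)]
  note eqs = extend_right[OF pb(9)] extend_right[OF assms(9)]
  {
    assume R: "is_pullback X r b t p"
    note pR = is_pullbackD[OF R]
    show "is_pullback X (r \<cdot> i) b f (p \<cdot> z)"
    proof (rule is_pullbackI)
      show "(r \<cdot> i) \<cdot> f = b \<cdot> (p \<cdot> z)" using assms pb by (simp add: eqs)
      fix u v
      assume uv: "u \<in> Arr X" "v \<in> Arr X" "Dom X v = Dom X u" "Cod X u = Dom X f"
        "Cod X v = Dom X (p \<cdot> z)" "u \<cdot> f = v \<cdot> (p \<cdot> z)"
      then have "u \<cdot> f = (v \<cdot> p) \<cdot> z" using assms pb by simp
      then have x: "pair X i t u (v \<cdot> p) \<in> Arr X" "Dom X (pair X i t u (v \<cdot> p)) = Dom X u"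
        "Cod X (pair X i t u (v \<cdot> p)) = Dom X i" "pair X i t u (v \<cdot> p) \<cdot> i = u"
        "pair X i t u (v \<cdot> p) \<cdot> t = v \<cdot> p"
        using pair[OF assms(1), of u "v \<cdot> p"] uv assms pb by simp_all
      define x' where "x' = pair X i t u (v \<cdot> p)"
      note x = x[folded x'_def]
      have y: "pair X r b x' v \<in> Arr X" "Dom X (pair X r b x' v) = Dom X u"
        "Cod X (pair X r b x' v) = Dom X r" "pair X r b x' v \<cdot> r = x'" "pair X r b x' v \<cdot> b = v"
        using pair[OF R, of x' v] uv x assms pb by simp_all
      moreover have "pair X r b x' v \<cdot> (r \<cdot> i) = u"
        using extend_right[OF y(4), of i] x y assms pb by simp
      ultimately show "\<exists>w. w \<in> Arr X \<and> Dom X w = Dom X u \<and> Cod X w = Dom X (r \<cdot> i) \<and>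
          w \<cdot> (r \<cdot> i) = u \<and> w \<cdot> b = v"
        using assms pb by (intro exI[of _ "pair X r b x' v"]) simp
    next
      fix w w'
      assume w: "w \<in> Arr X" "w' \<in> Arr X" "Dom X w = Dom X w'" "Cod X w = Dom X (r \<cdot> i)"
        "Cod X w' = Dom X (r \<cdot> i)" "w \<cdot> (r \<cdot> i) = w' \<cdot> (r \<cdot> i)" "w \<cdot> b = w' \<cdot> b"
      have e: "w \<cdot> (r \<cdot> t) = w' \<cdot> (r \<cdot> t)"
        using extend_right[OF w(7), of p] w assms pb by simp
      have e': "w \<cdot> r = w' \<cdot> r"
        by (rule pullback_ext[OF assms(1)]) (use w e assms pb in simp_all)
      show "w = w'"
        by (rule pullback_ext[OF R]) (use w e' assms pb in simp_all)
    qed (use assms pb in simp_all)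
  }
  {
    assume O: "is_pullback X (r \<cdot> i) b f (p \<cdot> z)"
    show "is_pullback X r b t p"
    proof (rule is_pullbackI)
      fix u v
      assume uv: "u \<in> Arr X" "v \<in> Arr X" "Dom X v = Dom X u" "Cod X u = Dom X t"
        "Cod X v = Dom X p" "u \<cdot> t = v \<cdot> p"
      have "u \<cdot> (t \<cdot> z) = v \<cdot> (p \<cdot> z)"
        using extend_right[OF uv(6), of z] uv assms pb by simp
      then have e: "(u \<cdot> i) \<cdot> f = v \<cdot> (p \<cdot> z)" using uv assms pb by simp
      define y where "y = pair X (r \<cdot> i) b (u \<cdot> i) v"
      have y: "y \<in> Arr X" "Dom X y = Dom X u" "Cod X y = Dom X r" "y \<cdot> (r \<cdot> i) = u \<cdot> i" "y \<cdot> b = v"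
        using pair[OF O _ _ _ _ _ e] uv assms pb unfolding y_def by simp_all
      have e': "y \<cdot> (r \<cdot> t) = u \<cdot> t"
        using extend_right[OF y(5), of p] uv y assms pb by simp
      have "y \<cdot> r = u"
        by (rule pullback_ext[OF assms(1)]) (use uv y e' assms pb in simp_all)
      then show "\<exists>w. w \<in> Arr X \<and> Dom X w = Dom X u \<and> Cod X w = Dom X r \<and> w \<cdot> r = u \<and> w \<cdot> b = v"
        using y by blast
    next
      fix w w'
      assume w: "w \<in> Arr X" "w' \<in> Arr X" "Dom X w = Dom X w'" "Cod X w = Dom X r"
        "Cod X w' = Dom X r" "w \<cdot> r = w' \<cdot> r" "w \<cdot> b = w' \<cdot> b"
      have e: "w \<cdot> (r \<cdot> i) = w' \<cdot> (r \<cdot> i)"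
        using extend_right[OF w(6), of i] w assms pb by simp
      show "w = w'"
        by (rule pullback_ext[OF O]) (use w e assms pb in simp_all)
    qed (use assms pb in simp_all)
  }
qed

lemma is_pullback_iso:
  assumes "is_pullback X a b f g"
    and j: "j \<in> Arr X" "k \<in> Arr X" "Cod X j = Dom X a" "Dom X k = Dom X a" "Cod X k = Dom X j"
      "j \<cdot> k = Ident X (Dom X j)" "k \<cdot> j = Ident X (Dom X a)"
  shows "is_pullback X (j \<cdot> a) (j \<cdot> b) f g"
proof (rule is_pullbackI)
  note pb = is_pullbackD[OF assms(1)]
  fix u v
  assume uv: "u \<in> Arr X" "v \<in> Arr X" "Dom X v = Dom X u" "Cod X u = Dom X f"
    "Cod X v = Dom X g" "u \<cdot> f = v \<cdot> g"
  note y = pair[OF assms(1) uv]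
  let ?y = "pair X a b u v"
  have "k \<cdot> (j \<cdot> c) = c" if "c \<in> Arr X" "Dom X c = Dom X a" for c
    using extend_right[OF j(7), of c] that j by simp
  then have "(?y \<cdot> k) \<cdot> (j \<cdot> a) = u" "(?y \<cdot> k) \<cdot> (j \<cdot> b) = v"
    using y j pb by simp_all
  then show "\<exists>w. w \<in> Arr X \<and> Dom X w = Dom X u \<and> Cod X w = Dom X (j \<cdot> a) \<and>
      w \<cdot> (j \<cdot> a) = u \<and> w \<cdot> (j \<cdot> b) = v"
    using y j pb by (intro exI[of _ "?y \<cdot> k"]) simp
next
  note pb = is_pullbackD[OF assms(1)]
  fix w w'
  assume w: "w \<in> Arr X" "w' \<in> Arr X" "Dom X w = Dom X w'" "Cod X w = Dom X (j \<cdot> a)"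
    "Cod X w' = Dom X (j \<cdot> a)" "w \<cdot> (j \<cdot> a) = w' \<cdot> (j \<cdot> a)" "w \<cdot> (j \<cdot> b) = w' \<cdot> (j \<cdot> b)"
  have "w \<cdot> j = w' \<cdot> j"
    by (rule pullback_ext[OF assms(1)]) (use w j pb in simp_all)
  from extend_right[OF this, of k] show "w = w'"
    using w j pb by simp
qed (use is_pullbackD[OF assms(1)] j in simp_all)

end


section \<open>Tangent pullbacks\<close>

context tangent_category
begin

lemma Tob_obj' [simp]: "A \<in> Obj X \<Longrightarrow> Tob X A \<in> Obj X"
  by (rule Tob_obj)

lemma Tar_typing [simp]:
  assumes "f \<in> Arr X"
  shows "Tar X f \<in> Arr X" "Dom X (Tar X f) = Tob X (Dom X f)" "Cod X (Tar X f) = Tob X (Cod X f)"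
  using Tar_hom[of f "Dom X f" "Cod X f"] assms by (simp_all add: hom_iff)

lemma Tar_comp' [simp]:
  assumes "f \<in> Arr X" "g \<in> Arr X" "Cod X f = Dom X g"
  shows "Tar X (f \<cdot> g) = Tar X f \<cdot> Tar X g"
  using Tar_comp[of f "Dom X f" "Dom X g" g "Cod X g"] assms by (simp add: hom_iff)

declare Tar_ident [simp]

lemma Tpow_obj [simp]: "A \<in> Obj X \<Longrightarrow> (Tob X ^^ m) A \<in> Obj X"
  by (induction m) simp_all

lemma Tpow_typing [simp]:
  assumes "f \<in> Arr X"
  shows "(Tar X ^^ m) f \<in> Arr X" "Dom X ((Tar X ^^ m) f) = (Tob X ^^ m) (Dom X f)"
    "Cod X ((Tar X ^^ m) f) = (Tob X ^^ m) (Cod X f)"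
  using assms by (induction m) simp_all

lemma Tpow_comp [simp]:
  assumes "f \<in> Arr X" "g \<in> Arr X" "Cod X f = Dom X g"
  shows "(Tar X ^^ m) (f \<cdot> g) = (Tar X ^^ m) f \<cdot> (Tar X ^^ m) g"
  using assms by (induction m) simp_all

lemma Tpow_ident [simp]: "A \<in> Obj X \<Longrightarrow> (Tar X ^^ m) (Ident X A) = Ident X ((Tob X ^^ m) A)"
  by (induction m) simp_all

lemma tangent_pullback_pow:
  "tangent_pullback X a b f g \<Longrightarrow>
    is_pullback X ((Tar X ^^ m) a) ((Tar X ^^ m) b) ((Tar X ^^ m) f) ((Tar X ^^ m) g)"
  by (simp add: tangent_pullback_def)

lemma tangent_pullback_0: "tangent_pullback X a b f g \<Longrightarrow> is_pullback X a b f g"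
  using tangent_pullback_pow[of a b f g 0] by simp

lemma tangent_pullback_1:
  "tangent_pullback X a b f g \<Longrightarrow> is_pullback X (Tar X a) (Tar X b) (Tar X f) (Tar X g)"
  using tangent_pullback_pow[of a b f g 1] by simp

lemma tangent_pullback_2: "tangent_pullback X a b f g \<Longrightarrow>
    is_pullback X (Tar X (Tar X a)) (Tar X (Tar X b)) (Tar X (Tar X f)) (Tar X (Tar X g))"
  using tangent_pullback_pow[of a b f g 2] by (simp add: numeral_2_eq_2)

text \<open>Two pullbacks of the same cospan are isomorphic and functors preserve isomorphisms, so
  preservation by all \<open>T\<^sup>m\<close> is a property of the cospan. For a tangent display map the tangent
  pullbacks exist beforehand, which is why below no universal property has to be checked at a
  power of \<open>T\<close>.\<close>

lemma tangent_pullback_unique: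
  assumes T: "tangent_pullback X a b f g" and P: "is_pullback X a' b' f g"
  shows "tangent_pullback X a' b' f g"
  unfolding tangent_pullback_def
proof
  fix m
  note T0 = tangent_pullback_0[OF T]
  note t = is_pullbackD[OF T0] and p = is_pullbackD[OF P]
  define j where "j = pair X a b a' b'"
  define k where "k = pair X a' b' a b"
  have j: "j \<in> Arr X" "Dom X j = Dom X a'" "Cod X j = Dom X a" "j \<cdot> a = a'" "j \<cdot> b = b'"
    using pair[OF T0, of a' b'] p unfolding j_def by simp_all
  have k: "k \<in> Arr X" "Dom X k = Dom X a" "Cod X k = Dom X a'" "k \<cdot> a' = a" "k \<cdot> b' = b"
    using pair[OF P, of a b] t unfolding k_def by simp_all
  have jk: "j \<cdot> k = Ident X (Dom X j)"
    by (rule pullback_ext[OF P]) (use j k t p in simp_all)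
  have kj: "k \<cdot> j = Ident X (Dom X a)"
    by (rule pullback_ext[OF T0]) (use j k t p in simp_all)
  have "is_pullback X ((Tar X ^^ m) j \<cdot> (Tar X ^^ m) a) ((Tar X ^^ m) j \<cdot> (Tar X ^^ m) b)
      ((Tar X ^^ m) f) ((Tar X ^^ m) g)"
    by (rule is_pullback_iso[OF tangent_pullback_pow[OF T], where k = "(Tar X ^^ m) k"])
      (use j k t p jk kj in \<open>simp_all flip: Tpow_comp\<close>)
  moreover have "(Tar X ^^ m) j \<cdot> (Tar X ^^ m) a = (Tar X ^^ m) a'"
    "(Tar X ^^ m) j \<cdot> (Tar X ^^ m) b = (Tar X ^^ m) b'"
    using j t by (simp_all flip: Tpow_comp)
  ultimately show "is_pullback X ((Tar X ^^ m) a') ((Tar X ^^ m) b') ((Tar X ^^ m) f) ((Tar X ^^ m) g)"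
    by simp
qed

lemma tangent_pullback_paste_iff:
  assumes "tangent_pullback X i t f z"
    and "r \<in> Arr X" "b \<in> Arr X" "p \<in> Arr X" "Dom X r = Dom X b" "Cod X r = Dom X i"
    "Cod X b = Dom X p" "Cod X p = Dom X z" "r \<cdot> t = b \<cdot> p"
  shows "tangent_pullback X r b t p \<longleftrightarrow> tangent_pullback X (r \<cdot> i) b f (p \<cdot> z)"
proof -
  note pb = is_pullbackD[OF tangent_pullback_0[OF assms(1)]]
  have "(Tar X ^^ m) r \<cdot> (Tar X ^^ m) t = (Tar X ^^ m) b \<cdot> (Tar X ^^ m) p" for m
    using assms pb by (simp flip: Tpow_comp)
  then have "is_pullback X ((Tar X ^^ m) r) ((Tar X ^^ m) b) ((Tar X ^^ m) t) ((Tar X ^^ m) p) \<longleftrightarrow>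
    is_pullback X ((Tar X ^^ m) r \<cdot> (Tar X ^^ m) i) ((Tar X ^^ m) b) ((Tar X ^^ m) f)
      ((Tar X ^^ m) p \<cdot> (Tar X ^^ m) z)" for m
    using pullback_paste_iff[OF tangent_pullback_pow[OF assms(1), of m],
        of "(Tar X ^^ m) r" "(Tar X ^^ m) b" "(Tar X ^^ m) p"] assms pb by simp
  then show ?thesis
    unfolding tangent_pullback_def using assms pb by simp
qed

lemma Tar_pair:
  assumes "tangent_pullback X a b f g" "u \<in> Arr X" "v \<in> Arr X" "Dom X v = Dom X u"
    "Cod X u = Dom X f" "Cod X v = Dom X g" "u \<cdot> f = v \<cdot> g"
  shows "Tar X (pair X a b u v) = pair X (Tar X a) (Tar X b) (Tar X u) (Tar X v)"
proof -
  note pb = is_pullbackD[OF tangent_pullback_0[OF assms(1)]]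
  note p = pair[OF tangent_pullback_0[OF assms(1)] assms(2-7)]
  show ?thesis
    by (rule pair_eqI[symmetric, OF tangent_pullback_1[OF assms(1)]])
      (use p pb assms in \<open>simp_all flip: Tar_comp'\<close>)
qed

text \<open>Fibre powers are iterated pullbacks: \<open>E\<^bsub>n+1\<^esub>\<close> is the pullback of \<open>q\<close> along \<open>E\<^sub>n \<rightarrow> M\<close>.\<close>

lemma is_fibre_power_Suc:
  assumes "is_fibre_power X q n h \<pi>" "is_pullback X a b q h"
    and "\<And>i. i < n \<Longrightarrow> \<pi>' i = b \<cdot> \<pi> i" "\<pi>' n = a"
  shows "is_fibre_power X q (Suc n) (b \<cdot> h) \<pi>'"
proof -
  note pb = is_pullbackD[OF assms(2)]
  have P: "\<pi> i \<in> Arr X" "Dom X (\<pi> i) = Dom X h" "Cod X (\<pi> i) = Dom X q" "\<pi> i \<cdot> q = h" if "i < n" for i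
    using assms(1) that by (auto simp: is_fibre_power_def hom_iff)
  have P': "\<pi>' i \<in> hom X (Dom X (b \<cdot> h)) (Dom X q)" "\<pi>' i \<cdot> q = b \<cdot> h" if "i < Suc n" for i
  proof -
    have "i < n \<or> i = n" using that by auto
    then show "\<pi>' i \<in> hom X (Dom X (b \<cdot> h)) (Dom X q)" "\<pi>' i \<cdot> q = b \<cdot> h"
      using P pb assms(3,4) by (auto simp: hom_iff)
  qed
  have univ: "\<exists>!w. w \<in> hom X Q (Dom X (b \<cdot> h)) \<and> w \<cdot> (b \<cdot> h) = k \<and> (\<forall>i<Suc n. w \<cdot> \<pi>' i = u i)"
    if k: "k \<in> hom X Q (Cod X q)" and u: "\<forall>i<Suc n. u i \<in> hom X Q (Dom X q) \<and> u i \<cdot> q = k"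
    for Q k u
  proof (rule ex_ex1I)
    have "\<forall>i<n. u i \<in> hom X Q (Dom X q) \<and> u i \<cdot> q = k" using u by simp
    then have "\<exists>!w. w \<in> hom X Q (Dom X h) \<and> w \<cdot> h = k \<and> (\<forall>i<n. w \<cdot> \<pi> i = u i)"
      using assms(1) k unfolding is_fibre_power_def by blast
    then obtain w where w: "w \<in> hom X Q (Dom X h)" "w \<cdot> h = k" "\<forall>i<n. w \<cdot> \<pi> i = u i"
      and w_uniq: "\<And>w'. w' \<in> hom X Q (Dom X h) \<Longrightarrow> w' \<cdot> h = k \<Longrightarrow> \<forall>i<n. w' \<cdot> \<pi> i = u i \<Longrightarrow> w' = w"
      by blast
    have un: "u n \<in> Arr X" "Dom X (u n) = Q" "Cod X (u n) = Dom X q" "u n \<cdot> q = k"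
      using u by (auto simp: hom_iff)
    have w': "w \<in> Arr X" "Dom X w = Q" "Cod X w = Dom X h" using w by (auto simp: hom_iff)
    have y: "pair X a b (u n) w \<in> Arr X" "Dom X (pair X a b (u n) w) = Q"
      "Cod X (pair X a b (u n) w) = Dom X a" "pair X a b (u n) w \<cdot> a = u n"
      "pair X a b (u n) w \<cdot> b = w"
      using pair[OF assms(2), of "u n" w] un w' w(2) by simp_all
    have "pair X a b (u n) w \<cdot> (b \<cdot> h) = k"
      using extend_right[OF y(5), of h] y w pb by simp
    moreover have "pair X a b (u n) w \<cdot> \<pi>' i = u i" if "i < Suc n" for i
    proof -
      have "i < n \<or> i = n" using that by auto
      then show ?thesis
        using extend_right[OF y(5), of "\<pi> i"] y w P pb assms(3,4) by auto
    qed
    ultimately show "\<exists>w. w \<in> hom X Q (Dom X (b \<cdot> h)) \<and> w \<cdot> (b \<cdot> h) = k \<and> (\<forall>i<Suc n. w \<cdot> \<pi>' i = u i)"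
      using y pb by (intro exI[of _ "pair X a b (u n) w"]) (simp add: hom_iff)
    fix x x'
    assume x: "x \<in> hom X Q (Dom X (b \<cdot> h)) \<and> x \<cdot> (b \<cdot> h) = k \<and> (\<forall>i<Suc n. x \<cdot> \<pi>' i = u i)"
      and x': "x' \<in> hom X Q (Dom X (b \<cdot> h)) \<and> x' \<cdot> (b \<cdot> h) = k \<and> (\<forall>i<Suc n. x' \<cdot> \<pi>' i = u i)"
    have b_comp: "y \<cdot> b = w" if y: "y \<in> hom X Q (Dom X (b \<cdot> h))" "y \<cdot> (b \<cdot> h) = k"
      "\<forall>i<Suc n. y \<cdot> \<pi>' i = u i" for y
    proof (rule w_uniq)
      show "\<forall>i<n. (y \<cdot> b) \<cdot> \<pi> i = u i"
        using y P pb assms(3) by (auto simp: hom_iff) (metis less_SucI)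
    qed (use y pb in \<open>simp_all add: hom_iff\<close>)
    show "x = x'"
      by (rule pullback_ext[OF assms(2)])
        (use x x' pb b_comp[of x] b_comp[of x'] assms(4) in \<open>auto simp: hom_iff\<close>)
  qed
  show ?thesis
    unfolding is_fibre_power_def using P' univ pb by simp
qed

lemma display_pullback_T:
  assumes "tangent_display_map X r" "f \<in> Arr X" "Cod X f = Tob X (Cod X r)"
  obtains a b where "tangent_pullback X a b (Tar X r) f"
proof -
  have "f \<in> Arr X \<and> Cod X f = (Tob X ^^ 1) (Cod X r)" using assms by simp
  then have "\<exists>a b. tangent_pullback X a b ((Tar X ^^ 1) r) f"
    using assms(1) unfolding tangent_display_map_def by blast
  then show ?thesis using that by auto
qed

lemma display_tangent_fibre_powers:
  assumes "tangent_display_map X q"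
  shows "has_tangent_fibre_powers X q"
  unfolding has_tangent_fibre_powers_def
proof
  fix n
  have q: "q \<in> Arr X" using assms by (simp add: tangent_display_map_def)
  show "\<exists>h \<pi>. \<forall>m. is_fibre_power X ((Tar X ^^ m) q) n ((Tar X ^^ m) h) (\<lambda>i. (Tar X ^^ m) (\<pi> i))"
  proof (induction n)
    case 0
    have "is_fibre_power X ((Tar X ^^ m) q) 0 ((Tar X ^^ m) (Ident X (Cod X q))) (\<lambda>i. (Tar X ^^ m) q)" for m
      unfolding is_fibre_power_def using q by (auto simp: hom_iff)
    then show ?case by (intro exI[of _ "Ident X (Cod X q)"] exI[of _ "\<lambda>i. q"] allI)
  next
    case (Suc n)
    then obtain h \<pi> where
      h: "\<And>m. is_fibre_power X ((Tar X ^^ m) q) n ((Tar X ^^ m) h) (\<lambda>i. (Tar X ^^ m) (\<pi> i))"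
      by blast
    have h0: "h \<in> Arr X" "Cod X h = Cod X q"
      and P: "\<And>i. i < n \<Longrightarrow> \<pi> i \<in> Arr X \<and> Dom X (\<pi> i) = Dom X h \<and> Cod X (\<pi> i) = Dom X q"
      using h[of 0] by (auto simp: is_fibre_power_def hom_iff)
    have "\<exists>a b. tangent_pullback X a b ((Tar X ^^ 0) q) h"
      using assms h0 unfolding tangent_display_map_def by (metis funpow_0)
    then obtain a b where ab: "tangent_pullback X a b q h" by auto
    note pb = is_pullbackD[OF tangent_pullback_0[OF ab]]
    define \<pi>' where "\<pi>' i = (if i < n then b \<cdot> \<pi> i else a)" for i
    have "is_fibre_power X ((Tar X ^^ m) q) (Suc n) ((Tar X ^^ m) (b \<cdot> h)) (\<lambda>i. (Tar X ^^ m) (\<pi>' i))"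
      for m
      using is_fibre_power_Suc[OF h[of m] tangent_pullback_pow[OF ab, of m],
          where \<pi>' = "\<lambda>i. (Tar X ^^ m) (\<pi>' i)"] P pb by (simp add: \<pi>'_def)
    then show ?case by blast
  qed
qed

end


section \<open>Fibrewise sums\<close>

context category
begin

text \<open>The part of an additive bundle that makes \<open>bsum\<close> well behaved. Unlike the monoid laws, which
  quantify over generalized elements, it visibly passes to the image under \<open>T\<close>.\<close>

definition fibred_sum :: "('m, 'b) additive_data_scheme \<Rightarrow> bool" where
  "fibred_sum B \<longleftrightarrow> is_pullback X (pr1 B) (pr2 B) (proj B) (proj B) \<and>
     plus B \<in> Arr X \<and> Dom X (plus B) = Dom X (pr1 B) \<and> Cod X (plus B) = Dom X (proj B) \<and>
     plus B \<cdot> proj B = pr1 B \<cdot> proj B"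

lemma fibred_sumD:
  assumes "fibred_sum B"
  shows "is_pullback X (pr1 B) (pr2 B) (proj B) (proj B)" "plus B \<in> Arr X"
    "Dom X (plus B) = Dom X (pr1 B)" "Cod X (plus B) = Dom X (proj B)"
    "plus B \<cdot> proj B = pr1 B \<cdot> proj B"
  using assms by (simp_all add: fibred_sum_def)

lemma bsum:
  assumes "fibred_sum B" "u \<in> Arr X" "v \<in> Arr X" "Dom X v = Dom X u"
    "Cod X u = Dom X (proj B)" "Cod X v = Dom X (proj B)" "u \<cdot> proj B = v \<cdot> proj B"
  shows "bsum X B u v \<in> Arr X" "Dom X (bsum X B u v) = Dom X u"
    "Cod X (bsum X B u v) = Dom X (proj B)" "bsum X B u v \<cdot> proj B = u \<cdot> proj B"
proof -
  note S = fibred_sumD[OF assms(1)]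
  note pb = is_pullbackD[OF S(1)]
  note p = pair[OF S(1) assms(2-7)]
  show "bsum X B u v \<in> Arr X" "Dom X (bsum X B u v) = Dom X u"
    "Cod X (bsum X B u v) = Dom X (proj B)"
    using p S by (simp_all add: bsum_def)
  show "bsum X B u v \<cdot> proj B = u \<cdot> proj B"
    using p S pb extend_right[OF p(4), of "proj B"] by (simp add: bsum_def)
qed

lemma comp_bsum:
  assumes "fibred_sum B" "u \<in> Arr X" "v \<in> Arr X" "Dom X v = Dom X u"
    "Cod X u = Dom X (proj B)" "Cod X v = Dom X (proj B)" "u \<cdot> proj B = v \<cdot> proj B"
    "k \<in> Arr X" "Cod X k = Dom X u"
  shows "k \<cdot> bsum X B u v = bsum X B (k \<cdot> u) (k \<cdot> v)"
proof -
  note S = fibred_sumD[OF assms(1)]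
  note p = pair[OF S(1) assms(2-7)]
  have "k \<cdot> bsum X B u v = (k \<cdot> pair X (pr1 B) (pr2 B) u v) \<cdot> plus B"
    using p S assms(8,9) by (simp add: bsum_def)
  then show ?thesis
    by (simp add: comp_pair[OF S(1) assms(2-9)] bsum_def)
qed

lemma plus_eq_bsum: "fibred_sum B \<Longrightarrow> plus B = bsum X B (pr1 B) (pr2 B)"
proof -
  assume "fibred_sum B"
  note S = fibred_sumD[OF this]
  note pb = is_pullbackD[OF S(1)]
  have "pair X (pr1 B) (pr2 B) (pr1 B) (pr2 B) = Ident X (Dom X (pr1 B))"
    by (rule pair_eqI[OF S(1)]) (use pb in simp_all)
  then show ?thesis using S by (simp add: bsum_def)
qed

lemma bsum_comp_morphism:
  assumes "fibred_sum B" "fibred_sum B'" "bundle_morphism X B B' f g"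
    and plus: "plus B \<cdot> g = bsum X B' (pr1 B \<cdot> g) (pr2 B \<cdot> g)"
    and "u \<in> Arr X" "v \<in> Arr X" "Dom X v = Dom X u"
    "Cod X u = Dom X (proj B)" "Cod X v = Dom X (proj B)" "u \<cdot> proj B = v \<cdot> proj B"
  shows "bsum X B u v \<cdot> g = bsum X B' (u \<cdot> g) (v \<cdot> g)"
    "(u \<cdot> g) \<cdot> proj B' = (v \<cdot> g) \<cdot> proj B'"
proof -
  note S = fibred_sumD[OF assms(1)] and S' = fibred_sumD[OF assms(2)]
  note pb = is_pullbackD[OF S(1)] and pb' = is_pullbackD[OF S'(1)]
  have fg: "f \<in> Arr X" "Dom X f = Cod X (proj B)" "Cod X f = Cod X (proj B')"
    "g \<in> Arr X" "Dom X g = Dom X (proj B)" "Cod X g = Dom X (proj B')" "g \<cdot> proj B' = proj B \<cdot> f"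
    using assms(3) by (auto simp: bundle_morphism_def hom_iff)
  note p = pair[OF S(1) assms(5-10)]
  have "bsum X B u v \<cdot> g = pair X (pr1 B) (pr2 B) u v \<cdot> bsum X B' (pr1 B \<cdot> g) (pr2 B \<cdot> g)"
    using p S fg by (simp add: bsum_def plus[unfolded bsum_def])
  also have "\<dots> = bsum X B' (pair X (pr1 B) (pr2 B) u v \<cdot> (pr1 B \<cdot> g))
      (pair X (pr1 B) (pr2 B) u v \<cdot> (pr2 B \<cdot> g))"
    by (rule comp_bsum[OF assms(2)])
      (use p pb fg pb' extend_right[OF pb(9), of f] in simp_all)
  also have "\<dots> = bsum X B' (u \<cdot> g) (v \<cdot> g)"
    using extend_right[OF p(4), of g] extend_right[OF p(5), of g] p pb fg by simp
  finally show "bsum X B u v \<cdot> g = bsum X B' (u \<cdot> g) (v \<cdot> g)" .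
  show "(u \<cdot> g) \<cdot> proj B' = (v \<cdot> g) \<cdot> proj B'"
    using extend_right[OF assms(10), of f] assms fg pb pb' by simp
qed

lemma additive_bundle_fibred_sum:
  assumes "additive_bundle X B"
  shows "fibred_sum B"
  using assms unfolding additive_bundle_def fibred_sum_def Let_def hom_iff by blast

lemma additive_bundle_zero:
  assumes "additive_bundle X B"
  shows "zero B \<in> Arr X" "Dom X (zero B) = Cod X (proj B)" "Cod X (zero B) = Dom X (proj B)"
    "zero B \<cdot> proj B = Ident X (Cod X (proj B))"
  using assms unfolding additive_bundle_def Let_def hom_iff by blast+

lemma bsum_zero:
  assumes "additive_bundle X B" "u \<in> Arr X" "Cod X u = Dom X (proj B)" "u \<cdot> proj B = k"
  shows "bsum X B u (k \<cdot> zero B) = u" "bsum X B (k \<cdot> zero B) u = u"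
proof -
  note S = fibred_sumD[OF additive_bundle_fibred_sum[OF assms(1)]]
  note pb = is_pullbackD[OF S(1)]
  note z = additive_bundle_zero[OF assms(1)]
  have k: "k \<in> Arr X" "Dom X k = Dom X u" "Cod X k = Cod X (proj B)"
    using assms(2,3) pb by (simp_all flip: assms(4))
  have u: "u \<in> hom X (Dom X u) (Dom X (proj B))" using assms by (simp add: hom_iff)
  have "bsum X B u (u \<cdot> proj B \<cdot> zero B) = u"
    using assms(1) u unfolding additive_bundle_def Let_def by blast
  then show *: "bsum X B u (k \<cdot> zero B) = u" using assms(4) by simp
  have "k \<cdot> zero B \<in> hom X (Dom X u) (Dom X (proj B))" using k z by (simp add: hom_iff)
  moreover have "(k \<cdot> zero B) \<cdot> proj B = u \<cdot> proj B" using k z pb assms by simp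
  moreover have "\<forall>Q u v. u \<in> hom X Q (Dom X (proj B)) \<and> v \<in> hom X Q (Dom X (proj B)) \<and>
      u \<cdot> proj B = v \<cdot> proj B \<longrightarrow> bsum X B u v = bsum X B v u"
    using assms(1) unfolding additive_bundle_def Let_def by blast
  ultimately have "bsum X B (k \<cdot> zero B) u = bsum X B u (k \<cdot> zero B)"
    using u by blast
  then show "bsum X B (k \<cdot> zero B) u = u" using * by simp
qed

end


section \<open>Sums, zeros and lifts of the tangent bundle\<close>

context tangent_category
begin

lemma tangent_bundle_simps [simp]:
  "proj (tangent_bundle X A) = tp X A" "zero (tangent_bundle X A) = tz X A"
  "plus (tangent_bundle X A) = ts X A" "pr1 (tangent_bundle X A) = tpr1 X A"
  "pr2 (tangent_bundle X A) = tpr2 X A" "lift (tangent_bundle X A) = tl X A"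
  by (simp_all add: tangent_bundle_def)

lemma T_additive_simps [simp]:
  "proj (T_additive X B) = Tar X (proj B)" "zero (T_additive X B) = Tar X (zero B)"
  "plus (T_additive X B) = Tar X (plus B)" "pr1 (T_additive X B) = Tar X (pr1 B)"
  "pr2 (T_additive X B) = Tar X (pr2 B)"
  by (simp_all add: T_additive_def)

lemma structure_typing [simp]:
  assumes "A \<in> Obj X"
  shows "tp X A \<in> Arr X" "Dom X (tp X A) = Tob X A" "Cod X (tp X A) = A"
    "tz X A \<in> Arr X" "Dom X (tz X A) = A" "Cod X (tz X A) = Tob X A"
    "tl X A \<in> Arr X" "Dom X (tl X A) = Tob X A" "Cod X (tl X A) = Tob X (Tob X A)"
    "tc X A \<in> Arr X" "Dom X (tc X A) = Tob X (Tob X A)" "Cod X (tc X A) = Tob X (Tob X A)"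
  using tp_hom[OF assms] tz_hom[OF assms] tl_hom[OF assms] tc_hom[OF assms]
  by (simp_all add: hom_iff)

lemma tp_natural: "f \<in> Arr X \<Longrightarrow> Tar X f \<cdot> tp X (Cod X f) = tp X (Dom X f) \<cdot> f"
  by (rule tp_nat) (simp add: hom_iff)

lemma tz_natural: "f \<in> Arr X \<Longrightarrow> f \<cdot> tz X (Cod X f) = tz X (Dom X f) \<cdot> Tar X f"
  by (rule tz_nat) (simp add: hom_iff)

lemma tl_natural:
  "f \<in> Arr X \<Longrightarrow> Tar X f \<cdot> tl X (Cod X f) = tl X (Dom X f) \<cdot> Tar X (Tar X f)"
  by (rule tl_nat) (simp add: hom_iff)

lemma tangent_fibred_sum [simp]: "A \<in> Obj X \<Longrightarrow> fibred_sum (tangent_bundle X A)"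
  by (rule additive_bundle_fibred_sum[OF tp_additive])

lemma tz_tp: "A \<in> Obj X \<Longrightarrow> tz X A \<cdot> tp X A = Ident X A"
  using additive_bundle_zero[OF tp_additive] by simp

lemma fibred_sum_T:
  assumes "fibred_sum B" "tangent_pullback X (pr1 B) (pr2 B) (proj B) (proj B)"
  shows "fibred_sum (T_additive X B)"
  using fibred_sumD[OF assms(1)] tangent_pullback_1[OF assms(2)]
    is_pullbackD[OF tangent_pullback_0[OF assms(2)]]
  by (simp add: fibred_sum_def flip: Tar_comp')

lemma tangent_fibred_sum_T [simp]: "A \<in> Obj X \<Longrightarrow> fibred_sum (T_additive X (tangent_bundle X A))"
  by (rule fibred_sum_T) (simp_all add: T2_pullback)

lemma Tar_bsum:
  assumes "fibred_sum B" "tangent_pullback X (pr1 B) (pr2 B) (proj B) (proj B)"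
    "u \<in> Arr X" "v \<in> Arr X" "Dom X v = Dom X u"
    "Cod X u = Dom X (proj B)" "Cod X v = Dom X (proj B)" "u \<cdot> proj B = v \<cdot> proj B"
  shows "Tar X (bsum X B u v) = bsum X (T_additive X B) (Tar X u) (Tar X v)"
proof -
  note S = fibred_sumD[OF assms(1)]
  note p = pair[OF S(1) assms(3-8)]
  show ?thesis
    using p S by (simp add: bsum_def Tar_pair[OF assms(2-8)])
qed

text \<open>The sum of \<open>Tq\<close> is \<open>Ts\<^sub>q\<close>, so naturality of \<open>p\<close> at \<open>s\<^sub>q\<close> and at the projections of \<open>E\<^sub>2\<close> makes
  \<open>p\<close> a morphism from the sum of \<open>Tq\<close> to that of \<open>q\<close>.\<close>

lemma bsum_T_comp_tp:
  assumes "fibred_sum B" "tangent_pullback X (pr1 B) (pr2 B) (proj B) (proj B)"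
    "u \<in> Arr X" "v \<in> Arr X" "Dom X v = Dom X u"
    "Cod X u = Tob X (Dom X (proj B))" "Cod X v = Tob X (Dom X (proj B))"
    "u \<cdot> Tar X (proj B) = v \<cdot> Tar X (proj B)"
  shows "bsum X (T_additive X B) u v \<cdot> tp X (Dom X (proj B))
    = bsum X B (u \<cdot> tp X (Dom X (proj B))) (v \<cdot> tp X (Dom X (proj B)))"
proof (rule bsum_comp_morphism(1))
  note S = fibred_sumD[OF assms(1)]
  note pb = is_pullbackD[OF S(1)]
  note nat = tp_natural[of "proj B"] tp_natural[of "plus B"] tp_natural[of "pr1 B"]
    tp_natural[of "pr2 B"]
  show "bundle_morphism X (T_additive X B) B (tp X (Cod X (proj B))) (tp X (Dom X (proj B)))"
    using pb nat by (simp add: bundle_morphism_def hom_iff)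
  have "tp X (Dom X (pr1 B)) \<cdot> bsum X B (pr1 B) (pr2 B) =
    bsum X B (tp X (Dom X (pr1 B)) \<cdot> pr1 B) (tp X (Dom X (pr1 B)) \<cdot> pr2 B)"
    by (rule comp_bsum[OF assms(1)]) (use pb in simp_all)
  then show "plus (T_additive X B) \<cdot> tp X (Dom X (proj B)) =
    bsum X B (pr1 (T_additive X B) \<cdot> tp X (Dom X (proj B)))
      (pr2 (T_additive X B) \<cdot> tp X (Dom X (proj B)))"
    using S pb nat by (simp flip: plus_eq_bsum[OF assms(1)])
qed (use assms is_pullbackD[OF fibred_sumD(1)[OF assms(1)]] in \<open>simp_all add: fibred_sum_T\<close>)

lemma T_bsum_zero:
  assumes "additive_bundle X B" "tangent_pullback X (pr1 B) (pr2 B) (proj B) (proj B)"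
    "u \<in> Arr X" "Cod X u = Tob X (Dom X (proj B))" "u \<cdot> Tar X (proj B) = k"
  shows "bsum X (T_additive X B) u (k \<cdot> Tar X (zero B)) = u"
proof -
  note fs = additive_bundle_fibred_sum[OF assms(1)]
  note S = fibred_sumD[OF fs]
  note pb = is_pullbackD[OF S(1)]
  note z = additive_bundle_zero[OF assms(1)]
  let ?E = "Dom X (proj B)"
  have "bsum X B (Ident X ?E) (proj B \<cdot> zero B) = Ident X ?E"
    by (rule bsum_zero(1)[OF assms(1)]) (use pb in simp_all)
  moreover have "Tar X (bsum X B (Ident X ?E) (proj B \<cdot> zero B)) =
      bsum X (T_additive X B) (Tar X (Ident X ?E)) (Tar X (proj B \<cdot> zero B))"
    by (rule Tar_bsum[OF fs assms(2)]) (use pb z in simp_all)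
  ultimately have "u = u \<cdot> bsum X (T_additive X B) (Ident X (Tob X ?E)) (Tar X (proj B) \<cdot> Tar X (zero B))"
    using assms pb z by simp
  also have "\<dots> = bsum X (T_additive X B) (u \<cdot> Ident X (Tob X ?E)) (u \<cdot> (Tar X (proj B) \<cdot> Tar X (zero B)))"
    by (rule comp_bsum[OF fibred_sum_T[OF fs assms(2)]])
      (use assms pb z in \<open>simp_all flip: Tar_comp'\<close>)
  finally show ?thesis
    using extend_right[OF assms(5), of "Tar X (zero B)"] assms(3,4) pb z by simp
qed

lemma tangent_bsum_comp_Tar:
  assumes "f \<in> Arr X" "u \<in> Arr X" "v \<in> Arr X" "Dom X v = Dom X u"
    "Cod X u = Tob X (Dom X f)" "Cod X v = Tob X (Dom X f)"
    "u \<cdot> tp X (Dom X f) = v \<cdot> tp X (Dom X f)"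
  shows "bsum X (tangent_bundle X (Dom X f)) u v \<cdot> Tar X f
    = bsum X (tangent_bundle X (Cod X f)) (u \<cdot> Tar X f) (v \<cdot> Tar X f)"
proof (rule bsum_comp_morphism(1))
  show "bundle_morphism X (tangent_bundle X (Dom X f)) (tangent_bundle X (Cod X f)) f (Tar X f)"
    using assms(1) tp_natural by (simp add: bundle_morphism_def hom_iff)
  show "plus (tangent_bundle X (Dom X f)) \<cdot> Tar X f =
    bsum X (tangent_bundle X (Cod X f)) (pr1 (tangent_bundle X (Dom X f)) \<cdot> Tar X f)
      (pr2 (tangent_bundle X (Dom X f)) \<cdot> Tar X f)"
    using ts_nat[of f "Dom X f" "Cod X f"] assms(1) by (simp add: bsum_def hom_iff)
qed (use assms in simp_all)

lemma T_tangent_bsum_comp_Tar: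
  assumes "f \<in> Arr X" "u \<in> Arr X" "v \<in> Arr X" "Dom X v = Dom X u"
    "Cod X u = Tob X (Tob X (Dom X f))" "Cod X v = Tob X (Tob X (Dom X f))"
    "u \<cdot> Tar X (tp X (Dom X f)) = v \<cdot> Tar X (tp X (Dom X f))"
  shows "bsum X (T_additive X (tangent_bundle X (Dom X f))) u v \<cdot> Tar X (Tar X f)
    = bsum X (T_additive X (tangent_bundle X (Cod X f))) (u \<cdot> Tar X (Tar X f)) (v \<cdot> Tar X (Tar X f))"
proof (rule bsum_comp_morphism(1))
  let ?A = "tangent_bundle X (Dom X f)" and ?B = "tangent_bundle X (Cod X f)"
  have S: "fibred_sum ?A" "fibred_sum ?B" using assms(1) by simp_all
  note SA = fibred_sumD[OF S(1), simplified]
  note pA = is_pullbackD[OF SA(1)]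
  show "bundle_morphism X (T_additive X ?A) (T_additive X ?B) (Tar X f) (Tar X (Tar X f))"
    using assms(1) tp_natural[of f] by (simp add: bundle_morphism_def hom_iff flip: Tar_comp')
  have s: "ts X (Dom X f) \<cdot> Tar X f = bsum X ?B (tpr1 X (Dom X f) \<cdot> Tar X f) (tpr2 X (Dom X f) \<cdot> Tar X f)"
    using ts_nat[of f "Dom X f" "Cod X f"] assms(1) by (simp add: bsum_def hom_iff)
  have e: "(tpr1 X (Dom X f) \<cdot> Tar X f) \<cdot> tp X (Cod X f) = (tpr2 X (Dom X f) \<cdot> Tar X f) \<cdot> tp X (Cod X f)"
    using tp_natural[OF assms(1)] extend_right[OF pA(9), of f] assms(1) pA by simp
  have "Tar X (ts X (Dom X f) \<cdot> Tar X f) = bsum X (T_additive X ?B)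
      (Tar X (tpr1 X (Dom X f) \<cdot> Tar X f)) (Tar X (tpr2 X (Dom X f) \<cdot> Tar X f))"
    unfolding s by (rule Tar_bsum) (use S e pA assms(1) T2_pullback in simp_all)
  then show "plus (T_additive X ?A) \<cdot> Tar X (Tar X f) =
    bsum X (T_additive X ?B) (pr1 (T_additive X ?A) \<cdot> Tar X (Tar X f))
      (pr2 (T_additive X ?A) \<cdot> Tar X (Tar X f))"
    using SA pA assms(1) by simp
qed (use assms in simp_all)

lemma tl_Tp: "A \<in> Obj X \<Longrightarrow> tl X A \<cdot> Tar X (tp X A) = tp X A \<cdot> tz X A"
  using tl_additive[of A] by (simp add: additive_morphism_def bundle_morphism_def)

lemma tc_tp: "A \<in> Obj X \<Longrightarrow> tc X A \<cdot> tp X (Tob X A) = Tar X (tp X A)"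
  using tc_additive[of A] by (simp add: additive_morphism_def bundle_morphism_def)

lemma tl_tp: "A \<in> Obj X \<Longrightarrow> tl X A \<cdot> tp X (Tob X A) = tp X A \<cdot> tz X A"
  using extend_right[OF tl_tc, of A "tp X (Tob X A)"] by (simp add: tc_tp tl_Tp)

lemma tz_Tz: "A \<in> Obj X \<Longrightarrow> tz X A \<cdot> Tar X (tz X A) = tz X A \<cdot> tz X (Tob X A)"
  using tz_natural[of "tz X A"] by simp

lemma tz_tl: "A \<in> Obj X \<Longrightarrow> tz X A \<cdot> tl X A = tz X A \<cdot> tz X (Tob X A)"
  using tl_additive[of A] by (simp add: additive_morphism_def tz_Tz)

lemma bsum_tl_T:
  assumes "A \<in> Obj X" "u \<in> Arr X" "v \<in> Arr X" "Dom X v = Dom X u"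
    "Cod X u = Tob X A" "Cod X v = Tob X A" "u \<cdot> tp X A = v \<cdot> tp X A"
  shows "bsum X (tangent_bundle X A) u v \<cdot> tl X A
    = bsum X (T_additive X (tangent_bundle X A)) (u \<cdot> tl X A) (v \<cdot> tl X A)"
  by (rule bsum_comp_morphism(1)[where f = "tz X A"])
    (use assms tl_additive in \<open>simp_all add: additive_morphism_def\<close>)

lemma bsum_tc:
  assumes "A \<in> Obj X" "u \<in> Arr X" "v \<in> Arr X" "Dom X v = Dom X u"
    "Cod X u = Tob X (Tob X A)" "Cod X v = Tob X (Tob X A)"
    "u \<cdot> Tar X (tp X A) = v \<cdot> Tar X (tp X A)"
  shows "bsum X (T_additive X (tangent_bundle X A)) u v \<cdot> tc X A
    = bsum X (tangent_bundle X (Tob X A)) (u \<cdot> tc X A) (v \<cdot> tc X A)"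
  by (rule bsum_comp_morphism(1)[where f = "Ident X (Tob X A)"])
    (use assms tc_additive in \<open>simp_all add: additive_morphism_def\<close>)

text \<open>The lift is additive for the structure \<open>Tp\<close> by axiom; since \<open>l c = l\<close>, and \<open>c\<close> exchanges the
  two structures on \<open>T\<^sup>2\<close>, it is additive for \<open>p\<^sub>T\<close> as well.\<close>

lemma bsum_tl:
  assumes "A \<in> Obj X" "u \<in> Arr X" "v \<in> Arr X" "Dom X v = Dom X u"
    "Cod X u = Tob X A" "Cod X v = Tob X A" "u \<cdot> tp X A = v \<cdot> tp X A"
  shows "bsum X (tangent_bundle X A) u v \<cdot> tl X A
    = bsum X (tangent_bundle X (Tob X A)) (u \<cdot> tl X A) (v \<cdot> tl X A)"
proof -
  have e: "u \<cdot> (tl X A \<cdot> Tar X (tp X A)) = v \<cdot> (tl X A \<cdot> Tar X (tp X A))"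
    using extend_right[OF assms(7), of "tz X A"] assms by (simp add: tl_Tp)
  note b = bsum[of "tangent_bundle X A" u v]
  have "bsum X (tangent_bundle X A) u v \<cdot> tl X A = (bsum X (tangent_bundle X A) u v \<cdot> tl X A) \<cdot> tc X A"
    using b assms by (simp add: tl_tc)
  also have "\<dots> = bsum X (tangent_bundle X (Tob X A)) ((u \<cdot> tl X A) \<cdot> tc X A) ((v \<cdot> tl X A) \<cdot> tc X A)"
    unfolding bsum_tl_T[OF assms] by (rule bsum_tc) (use assms e in simp_all)
  finally show ?thesis using assms by (simp add: tl_tc)
qed

text \<open>The universality of \<open>l\<^sub>q\<close> is a property of \<open>\<xi>\<^sub>q\<close>, which is only used behind some \<open>w\<close> into \<open>E\<^sub>2\<close>;
  the last clause reduces \<open>w \<xi>\<^sub>q\<close> to a sum in the components of \<open>w\<close>.\<close>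

lemma comp_lift_xi:
  assumes "fibred_sum B" "tangent_pullback X (pr1 B) (pr2 B) (proj B) (proj B)"
    "lift B \<in> Arr X" "Dom X (lift B) = Dom X (proj B)" "Cod X (lift B) = Tob X (Dom X (proj B))"
    "lift B \<cdot> Tar X (proj B) = proj B \<cdot> tz X (Cod X (proj B))"
  shows "lift_xi X B \<in> Arr X" "Dom X (lift_xi X B) = Dom X (pr1 B)"
    "Cod X (lift_xi X B) = Tob X (Dom X (proj B))"
    "lift_xi X B \<cdot> Tar X (proj B) = pr1 B \<cdot> (proj B \<cdot> tz X (Cod X (proj B)))"
    "\<lbrakk>w \<in> Arr X; Cod X w = Dom X (pr1 B)\<rbrakk> \<Longrightarrow> w \<cdot> lift_xi X B = bsum X (T_additive X B)
       (w \<cdot> (pr1 B \<cdot> lift B)) (w \<cdot> (pr2 B \<cdot> tz X (Dom X (proj B))))"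
proof -
  note S = fibred_sumD[OF assms(1)]
  note pb = is_pullbackD[OF S(1)]
  have e: "(pr1 B \<cdot> lift B) \<cdot> Tar X (proj B) = (pr2 B \<cdot> tz X (Dom X (proj B))) \<cdot> Tar X (proj B)"
    using extend_right[OF pb(9), of "tz X (Cod X (proj B))"] pb assms tz_natural[of "proj B"] by simp
  have t: "pr1 B \<cdot> lift B \<in> Arr X" "pr2 B \<cdot> tz X (Dom X (proj B)) \<in> Arr X"
    "Dom X (pr2 B \<cdot> tz X (Dom X (proj B))) = Dom X (pr1 B \<cdot> lift B)"
    "Cod X (pr1 B \<cdot> lift B) = Dom X (proj (T_additive X B))"
    "Cod X (pr2 B \<cdot> tz X (Dom X (proj B))) = Dom X (proj (T_additive X B))"
    "(pr1 B \<cdot> lift B) \<cdot> proj (T_additive X B) = (pr2 B \<cdot> tz X (Dom X (proj B))) \<cdot> proj (T_additive X B)"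
    using e pb assms by simp_all
  note b = bsum[OF fibred_sum_T[OF assms(1,2)] t]
  show "lift_xi X B \<in> Arr X" "Dom X (lift_xi X B) = Dom X (pr1 B)"
    "Cod X (lift_xi X B) = Tob X (Dom X (proj B))"
    "lift_xi X B \<cdot> Tar X (proj B) = pr1 B \<cdot> (proj B \<cdot> tz X (Cod X (proj B)))"
    using b pb assms by (simp_all add: lift_xi_def)
  show "w \<cdot> lift_xi X B = bsum X (T_additive X B)
       (w \<cdot> (pr1 B \<cdot> lift B)) (w \<cdot> (pr2 B \<cdot> tz X (Dom X (proj B))))"
    if "w \<in> Arr X" "Cod X w = Dom X (pr1 B)"
    unfolding lift_xi_def
    by (rule comp_bsum[OF fibred_sum_T[OF assms(1,2)] t]) (use that pb assms in simp_all)
qed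

lemmas comp_lift_xi_tangent = comp_lift_xi[of "tangent_bundle X A" for A, simplified]

text \<open>\<open>l = \<langle>id, p z\<rangle> \<xi>\<close>, where \<open>\<xi>\<close> is a pullback projection whose partner only depends on \<open>u p\<close>;
  and \<open>u p\<close> can be recovered from \<open>u l\<close>, since \<open>l Tp = p z\<close> and \<open>z\<close> is split monic.\<close>

lemma tl_monic:
  assumes A: "A \<in> Obj X"
  shows "monic (tl X A)"
  unfolding monic_def
proof (intro conjI allI impI; (elim conjE)?)
  fix u v
  assume t: "u \<in> Arr X" "v \<in> Arr X" "Dom X u = Dom X v" "Cod X u = Dom X (tl X A)"
    "Cod X v = Dom X (tl X A)" and e: "u \<cdot> tl X A = v \<cdot> tl X A"
  let ?T = "tangent_bundle X A"
  note S = fibred_sumD[OF tangent_fibred_sum[OF A], simplified]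
  note pb = is_pullbackD[OF S(1)]
  have p: "u \<cdot> tp X A = (u \<cdot> tl X A) \<cdot> (Tar X (tp X A) \<cdot> tp X A)"
    if "u \<in> Arr X" "Cod X u = Tob X A" for u
    using that A extend_right[OF tl_Tp[OF A], of "tp X A"] by (simp add: tz_tp)
  have up: "u \<cdot> tp X A = v \<cdot> tp X A" using p[of u] p[of v] e t A by (simp del: assoc)
  define y where "y u = pair X (tpr1 X A) (tpr2 X A) u (u \<cdot> (tp X A \<cdot> tz X A))" for u
  have y: "y u \<in> Arr X" "Dom X (y u) = Dom X u" "Cod X (y u) = Dom X (tpr1 X A)"
    "y u \<cdot> tpr1 X A = u" "y u \<cdot> tpr2 X A = u \<cdot> (tp X A \<cdot> tz X A)"
    if "u \<in> Arr X" "Cod X u = Tob X A" for u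
    using pair[OF S(1), of u "u \<cdot> (tp X A \<cdot> tz X A)"] that A by (simp_all add: y_def tz_tp)
  have xi: "y u \<cdot> lift_xi X ?T = u \<cdot> tl X A" if u: "u \<in> Arr X" "Cod X u = Tob X A" for u
  proof -
    have "y u \<cdot> lift_xi X ?T =
        bsum X (T_additive X ?T) (y u \<cdot> (tpr1 X A \<cdot> tl X A)) (y u \<cdot> (tpr2 X A \<cdot> tz X (Tob X A)))"
      using comp_lift_xi_tangent(5)[of A "y u"] A y[OF u] pb by (simp add: T2_pullback tl_Tp)
    also have "y u \<cdot> (tpr1 X A \<cdot> tl X A) = u \<cdot> tl X A"
      using extend_right[OF y(4)[OF u], of "tl X A"] y[OF u] pb u A by simp
    also have "y u \<cdot> (tpr2 X A \<cdot> tz X (Tob X A)) = (u \<cdot> (tp X A \<cdot> tz X A)) \<cdot> Tar X (tz X A)"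
      using extend_right[OF y(5)[OF u], of "tz X (Tob X A)"] y[OF u] pb u A by (simp add: tz_Tz)
    also have "bsum X (T_additive X ?T) (u \<cdot> tl X A) ((u \<cdot> (tp X A \<cdot> tz X A)) \<cdot> Tar X (tz X A)) = u \<cdot> tl X A"
      using T_bsum_zero[OF tp_additive[OF A], of "u \<cdot> tl X A" "u \<cdot> (tp X A \<cdot> tz X A)"] u A
      by (simp add: T2_pullback tl_Tp)
    finally show ?thesis .
  qed
  have U: "is_pullback X (lift_xi X ?T) (tpr1 X A \<cdot> tp X A) (Tar X (tp X A)) (tz X A)"
    using tangent_pullback_0 tl_universal[OF A] A by (simp add: universal_lift_def)
  have e': "y u \<cdot> (tpr1 X A \<cdot> tp X A) = y v \<cdot> (tpr1 X A \<cdot> tp X A)"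
    using up extend_right[OF y(4), of u "tp X A"] extend_right[OF y(4), of v "tp X A"]
      y(1-3)[of u] y(1-3)[of v] t pb A by simp
  have "y u = y v"
    by (rule pullback_ext[OF U])
      (use y(1-3)[of u] y(1-3)[of v] t A xi[of u] xi[of v] e e' comp_lift_xi_tangent(2)[of A] in
        \<open>simp_all add: T2_pullback tl_Tp\<close>)
  moreover have "y u \<cdot> tpr1 X A = u" "y v \<cdot> tpr1 X A = v" using y(4) t A by simp_all
  ultimately show "u = v" by metis
qed (use A in simp_all)

text \<open>Since the lift \<open>l'\<close> of the target is monic, the two arrows may be compared after \<open>l'\<close>. There
  linearity turns \<open>g l'\<close> into \<open>l Tg\<close>, both lifts turn the sums of the bundles into sums of tangent
  vectors, and \<open>Tg\<close> preserves the latter by naturality of \<open>s\<close>.\<close>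

lemma linear_imp_additive:
  assumes "fibred_sum B" "fibred_sum B'"
    and l: "additive_morphism X B (tangent_bundle X (Dom X (proj B))) (zero B) (lift B)"
    and l': "additive_morphism X B' (tangent_bundle X (Dom X (proj B'))) (zero B') (lift B')"
    and "monic (lift B')" "linear_morphism X B B' f g"
  shows "plus B \<cdot> g = bsum X B' (pr1 B \<cdot> g) (pr2 B \<cdot> g)"
proof -
  note S = fibred_sumD[OF assms(1)] and S' = fibred_sumD[OF assms(2)]
  note pb = is_pullbackD[OF S(1)] and pb' = is_pullbackD[OF S'(1)]
  have L: "lift B \<in> Arr X" "Dom X (lift B) = Dom X (proj B)" "Cod X (lift B) = Tob X (Dom X (proj B))"
    "zero B \<in> Arr X" "Dom X (zero B) = Cod X (proj B)" "Cod X (zero B) = Dom X (proj B)"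
    "lift B \<cdot> tp X (Dom X (proj B)) = proj B \<cdot> zero B"
    "plus B \<cdot> lift B = bsum X (tangent_bundle X (Dom X (proj B))) (pr1 B \<cdot> lift B) (pr2 B \<cdot> lift B)"
    using l pb by (auto simp: additive_morphism_def bundle_morphism_def hom_iff)
  have L': "lift B' \<in> Arr X" "Dom X (lift B') = Dom X (proj B')" "Cod X (lift B') = Tob X (Dom X (proj B'))"
    using l' pb' by (auto simp: additive_morphism_def bundle_morphism_def hom_iff)
  have g: "f \<in> Arr X" "Dom X f = Cod X (proj B)" "Cod X f = Cod X (proj B')"
    "g \<in> Arr X" "Dom X g = Dom X (proj B)" "Cod X g = Dom X (proj B')" "g \<cdot> proj B' = proj B \<cdot> f"
    "g \<cdot> lift B' = lift B \<cdot> Tar X g"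
    using assms(6) by (auto simp: linear_morphism_def bundle_morphism_def hom_iff)
  have e: "(pr1 B \<cdot> lift B) \<cdot> tp X (Dom X (proj B)) = (pr2 B \<cdot> lift B) \<cdot> tp X (Dom X (proj B))"
    using extend_right[OF pb(9), of "zero B"] pb L by simp
  have e': "(pr1 B \<cdot> g) \<cdot> proj B' = (pr2 B \<cdot> g) \<cdot> proj B'"
    using extend_right[OF pb(9), of f] pb pb' g by simp
  have t: "pr1 B \<cdot> g \<in> Arr X" "pr2 B \<cdot> g \<in> Arr X" "Dom X (pr2 B \<cdot> g) = Dom X (pr1 B \<cdot> g)"
    "Cod X (pr1 B \<cdot> g) = Dom X (proj B')" "Cod X (pr2 B \<cdot> g) = Dom X (proj B')"
    using pb g by simp_all
  note b = bsum[OF assms(2) t e']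
  have "(plus B \<cdot> g) \<cdot> lift B' = bsum X (tangent_bundle X (Dom X (proj B)))
      (pr1 B \<cdot> lift B) (pr2 B \<cdot> lift B) \<cdot> Tar X g"
    using extend_right[OF L(8), of "Tar X g"] S L(1-7) L' g by simp
  also have "\<dots> = bsum X (tangent_bundle X (Dom X (proj B')))
      ((pr1 B \<cdot> lift B) \<cdot> Tar X g) ((pr2 B \<cdot> lift B) \<cdot> Tar X g)"
    using tangent_bsum_comp_Tar[of g "pr1 B \<cdot> lift B" "pr2 B \<cdot> lift B"] e pb L g by simp
  also have "\<dots> = bsum X (tangent_bundle X (Dom X (proj B')))
      ((pr1 B \<cdot> g) \<cdot> lift B') ((pr2 B \<cdot> g) \<cdot> lift B')"
    using pb L L' g by simp
  also have "\<dots> = bsum X B' (pr1 B \<cdot> g) (pr2 B \<cdot> g) \<cdot> lift B'"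
    by (rule bsum_comp_morphism(1)[symmetric, where f = "zero B'"])
      (use assms t e' l' pb' in \<open>simp_all add: additive_morphism_def\<close>)
  finally show ?thesis
    by (rule monicD[OF assms(5)]) (use S pb g L' b in simp_all)
qed

lemma tl_additive_tp:
  assumes A: "A \<in> Obj X"
  shows "additive_morphism X (tangent_bundle X A) (tangent_bundle X (Tob X A)) (tz X A) (tl X A)"
proof -
  note S = fibred_sumD[OF tangent_fibred_sum[OF A], simplified]
  note pb = is_pullbackD[OF S(1)]
  show ?thesis
    using bsum_tl[OF A, of "tpr1 X A" "tpr2 X A"] pb A
    by (simp add: additive_morphism_def bundle_morphism_def hom_iff tl_tp tz_tl
        plus_eq_bsum[OF tangent_fibred_sum[OF A], simplified])
qed

end


section \<open>The vertical bundle is a differential bundle\<close>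

locale vertical_setting = tangent_category X
  for X :: "('o, 'm, 'x) tangent_data_scheme" (structure) +
  fixes q \<iota> tV :: 'm and E M :: 'o and V :: "'m bundle_data"
  assumes q_hom: "q \<in> hom X E M"
    and q_display: "tangent_display_map X q"
    and vertical: "vertical_bundle X q V \<iota> tV"
    and V_display: "tangent_display_map X (proj V)"
begin

lemma q_typing [simp]:
  "q \<in> Arr X" "Dom X q = E" "Cod X q = M" "E \<in> Obj X" "M \<in> Obj X"
  using q_hom dom_obj[of q] cod_obj[of q] by (auto simp: hom_iff)

lemma V_pullback: "tangent_pullback X \<iota> tV (Tar X q) (tz X M)"
  using vertical by (simp add: vertical_bundle_def Let_def)

lemma iota_typing [simp]:
  "\<iota> \<in> Arr X" "Cod X \<iota> = Tob X E" "tV \<in> Arr X" "Dom X tV = Dom X \<iota>" "Cod X tV = M"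
  using is_pullbackD[OF tangent_pullback_0[OF V_pullback]] by simp_all

lemma iota_Tq: "\<iota> \<cdot> Tar X q = tV \<cdot> tz X M"
  using is_pullbackD[OF tangent_pullback_0[OF V_pullback]] by simp

lemma proj_V: "proj V = \<iota> \<cdot> tp X E"
  using vertical by (simp add: vertical_bundle_def Let_def)

lemma proj_V_typing [simp]: "proj V \<in> Arr X" "Dom X (proj V) = Dom X \<iota>" "Cod X (proj V) = E"
  by (simp_all add: proj_V)

lemma V2_pullback: "tangent_pullback X (pr1 V) (pr2 V) (proj V) (proj V)"
  using vertical unfolding vertical_bundle_def Let_def by blast

lemma V_typing [simp]:
  "pr1 V \<in> Arr X" "Cod X (pr1 V) = Dom X \<iota>"
  "pr2 V \<in> Arr X" "Dom X (pr2 V) = Dom X (pr1 V)" "Cod X (pr2 V) = Dom X \<iota>"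
  "zero V \<in> Arr X" "Dom X (zero V) = E" "Cod X (zero V) = Dom X \<iota>"
  "plus V \<in> Arr X" "Dom X (plus V) = Dom X (pr1 V)" "Cod X (plus V) = Dom X \<iota>"
  "lift V \<in> Arr X" "Dom X (lift V) = Dom X \<iota>" "Cod X (lift V) = Tob X (Dom X \<iota>)"
  using vertical is_pullbackD[OF tangent_pullback_0[OF V2_pullback]]
  by (simp_all add: vertical_bundle_def Let_def hom_iff)

lemma pr_V: "pr1 V \<cdot> proj V = pr2 V \<cdot> proj V"
  using is_pullbackD[OF tangent_pullback_0[OF V2_pullback]] by simp

lemma V_iota:
  "zero V \<cdot> \<iota> = tz X E"
  "plus V \<cdot> \<iota> = bsum X (tangent_bundle X E) (pr1 V \<cdot> \<iota>) (pr2 V \<cdot> \<iota>)"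
  "lift V \<cdot> Tar X \<iota> = \<iota> \<cdot> tl X E"
  using vertical by (simp_all add: vertical_bundle_def Let_def)

lemma tV_eq: "tV = \<iota> \<cdot> (tp X E \<cdot> q)"
proof -
  have "\<iota> \<cdot> (Tar X q \<cdot> tp X M) = tV"
    using extend_right[OF iota_Tq, of "tp X M"] by (simp add: tz_tp)
  then show ?thesis using tp_natural[of q] by simp
qed

lemma proj_V_q: "proj V \<cdot> q = tV"
  using tV_eq by (simp add: proj_V)

text \<open>\<open>T\<^sup>Vq\<close> is determined by \<open>\<iota>\<^sub>q\<close>, so the pullback projection \<open>\<iota>\<^sub>q\<close> and its images under \<open>T\<close> are
  monic. Hence every identity about the vertical bundle can be tested after \<open>\<iota>\<^sub>q\<close>, where it becomes
  one about the tangent bundle of \<open>E\<close>.\<close>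

lemma iota_monic: "monic \<iota>" "monic (Tar X \<iota>)" "monic (Tar X (Tar X \<iota>))"
proof -
  have e: "Tar X tV = Tar X \<iota> \<cdot> Tar X (tp X E \<cdot> q)"
    "Tar X (Tar X tV) = Tar X (Tar X \<iota>) \<cdot> Tar X (Tar X (tp X E \<cdot> q))"
    by (subst tV_eq, simp)+
  show "monic \<iota>"
    by (rule pullback_monic[OF tangent_pullback_0[OF V_pullback] tV_eq]) simp_all
  show "monic (Tar X \<iota>)"
    by (rule pullback_monic[OF tangent_pullback_1[OF V_pullback] e(1)]) simp_all
  show "monic (Tar X (Tar X \<iota>))"
    by (rule pullback_monic[OF tangent_pullback_2[OF V_pullback] e(2)]) simp_all
qed

lemma pr_V_iota: "(pr1 V \<cdot> \<iota>) \<cdot> tp X E = (pr2 V \<cdot> \<iota>) \<cdot> tp X E"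
  using pr_V by (simp add: proj_V)

lemma V_fibred_sum [simp]: "fibred_sum V"
proof -
  have "(plus V \<cdot> \<iota>) \<cdot> tp X E = (pr1 V \<cdot> \<iota>) \<cdot> tp X E"
    unfolding V_iota(2) using bsum(4)[of "tangent_bundle X E" "pr1 V \<cdot> \<iota>" "pr2 V \<cdot> \<iota>"] pr_V_iota by simp
  then show ?thesis
    using tangent_pullback_0[OF V2_pullback] by (simp add: fibred_sum_def) (simp add: proj_V)
qed

lemma bsum_V_iota:
  assumes "u \<in> Arr X" "v \<in> Arr X" "Dom X v = Dom X u" "Cod X u = Dom X \<iota>" "Cod X v = Dom X \<iota>"
    "u \<cdot> proj V = v \<cdot> proj V"
  shows "bsum X V u v \<cdot> \<iota> = bsum X (tangent_bundle X E) (u \<cdot> \<iota>) (v \<cdot> \<iota>)"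
  by (rule bsum_comp_morphism(1)[where f = "Ident X E"])
    (use assms in \<open>simp_all add: V_iota(2) bundle_morphism_def hom_iff\<close>, simp add: proj_V)

lemma zero_V: "zero V \<cdot> proj V = Ident X E" "zero V \<cdot> tV = q"
proof -
  show z: "zero V \<cdot> proj V = Ident X E"
    using extend_right[OF V_iota(1), of "tp X E"] by (simp add: proj_V tz_tp)
  show "zero V \<cdot> tV = q"
    using extend_right[OF z, of q] by (simp add: proj_V_q)
qed

lemma V_additive: "additive_bundle X V"
proof -
  let ?T = "tangent_bundle X E"
  have T: "\<And>Q u v w. u \<in> hom X Q (Tob X E) \<and> v \<in> hom X Q (Tob X E) \<and> w \<in> hom X Q (Tob X E) \<and>
      u \<cdot> tp X E = v \<cdot> tp X E \<and> v \<cdot> tp X E = w \<cdot> tp X E \<Longrightarrow>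
        bsum X ?T (bsum X ?T u v) w = bsum X ?T u (bsum X ?T v w)"
    "\<And>Q u v. u \<in> hom X Q (Tob X E) \<and> v \<in> hom X Q (Tob X E) \<and> u \<cdot> tp X E = v \<cdot> tp X E \<Longrightarrow>
        bsum X ?T u v = bsum X ?T v u"
    using tp_additive[of E] unfolding additive_bundle_def Let_def tangent_bundle_simps
    by (simp_all only: structure_typing q_typing) blast+
  have i: "u \<cdot> \<iota> \<in> hom X Q (Tob X E)" if "u \<in> hom X Q (Dom X \<iota>)" for u Q
    using that by (simp add: hom_iff)
  have p: "(u \<cdot> \<iota>) \<cdot> tp X E = u \<cdot> proj V" if "u \<in> hom X Q (Dom X \<iota>)" for u Q
    using that by (simp add: hom_iff proj_V)
  have B: "bsum X V u v \<in> hom X Q (Dom X \<iota>)" "bsum X V u v \<cdot> proj V = u \<cdot> proj V"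
    "bsum X V u v \<cdot> \<iota> = bsum X ?T (u \<cdot> \<iota>) (v \<cdot> \<iota>)"
    if "u \<in> hom X Q (Dom X \<iota>)" "v \<in> hom X Q (Dom X \<iota>)" "u \<cdot> proj V = v \<cdot> proj V" for u v Q
    using that bsum[of V u v] bsum_V_iota[of u v] by (simp_all add: hom_iff)
  have assoc: "bsum X V (bsum X V u v) w = bsum X V u (bsum X V v w)"
    if "u \<in> hom X Q (Dom X \<iota>) \<and> v \<in> hom X Q (Dom X \<iota>) \<and> w \<in> hom X Q (Dom X \<iota>) \<and>
      u \<cdot> proj V = v \<cdot> proj V \<and> v \<cdot> proj V = w \<cdot> proj V" for Q u v w
  proof -
    from that have u: "u \<in> hom X Q (Dom X \<iota>)" and v: "v \<in> hom X Q (Dom X \<iota>)"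
      and w: "w \<in> hom X Q (Dom X \<iota>)" and uv: "u \<cdot> proj V = v \<cdot> proj V"
      and vw: "v \<cdot> proj V = w \<cdot> proj V" by blast+
    have l: "bsum X V u v \<cdot> proj V = w \<cdot> proj V" using B(2)[OF u v uv] uv vw by simp
    have r: "u \<cdot> proj V = bsum X V v w \<cdot> proj V" using B(2)[OF v w vw] uv by simp
    have "bsum X V (bsum X V u v) w \<cdot> \<iota> = bsum X V u (bsum X V v w) \<cdot> \<iota>"
      unfolding B(3)[OF B(1)[OF u v uv] w l] B(3)[OF u B(1)[OF v w vw] r]
        B(3)[OF u v uv] B(3)[OF v w vw]
      by (rule T(1)) (use i[OF u] i[OF v] i[OF w] p[OF u] p[OF v] p[OF w] uv vw in auto)
    then show ?thesis
      by (rule monicD[OF iota_monic(1)])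
        (use B(1)[OF B(1)[OF u v uv] w l] B(1)[OF u B(1)[OF v w vw] r] in \<open>simp_all add: hom_iff\<close>)
  qed
  have comm: "bsum X V u v = bsum X V v u"
    if "u \<in> hom X Q (Dom X \<iota>) \<and> v \<in> hom X Q (Dom X \<iota>) \<and> u \<cdot> proj V = v \<cdot> proj V" for Q u v
  proof -
    from that have u: "u \<in> hom X Q (Dom X \<iota>)" and v: "v \<in> hom X Q (Dom X \<iota>)"
      and uv: "u \<cdot> proj V = v \<cdot> proj V" by blast+
    have "bsum X V u v \<cdot> \<iota> = bsum X V v u \<cdot> \<iota>"
      unfolding B(3)[OF u v uv] B(3)[OF v u uv[symmetric]]
      by (rule T(2)) (use i[OF u] i[OF v] p[OF u] p[OF v] uv in auto)
    then show ?thesis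
      by (rule monicD[OF iota_monic(1)])
        (use B(1)[OF u v uv] B(1)[OF v u uv[symmetric]] in \<open>simp_all add: hom_iff\<close>)
  qed
  have unit: "bsum X V u (u \<cdot> proj V \<cdot> zero V) = u" if u: "u \<in> hom X Q (Dom X \<iota>)" for Q u
  proof -
    have u': "u \<in> Arr X" "Dom X u = Q" "Cod X u = Dom X \<iota>" using u by (auto simp: hom_iff)
    have z: "u \<cdot> proj V \<cdot> zero V \<in> hom X Q (Dom X \<iota>)" "u \<cdot> proj V = (u \<cdot> proj V \<cdot> zero V) \<cdot> proj V"
      "(u \<cdot> proj V \<cdot> zero V) \<cdot> \<iota> = (u \<cdot> proj V) \<cdot> tz X E"
      using u' by (simp_all add: hom_iff zero_V V_iota)
    have "bsum X V u (u \<cdot> proj V \<cdot> zero V) \<cdot> \<iota> = u \<cdot> \<iota>"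
      unfolding B(3)[OF u z(1,2)] z(3)
      using bsum_zero(1)[OF tp_additive[of E], of "u \<cdot> \<iota>" "u \<cdot> proj V"] u' p[OF u] by simp
    then show ?thesis
      by (rule monicD[OF iota_monic(1)]) (use B(1)[OF u z(1,2)] u' in \<open>simp_all add: hom_iff\<close>)
  qed
  have s: "plus V \<cdot> proj V = pr1 V \<cdot> proj V" using fibred_sumD[OF V_fibred_sum] by simp
  show ?thesis
    unfolding additive_bundle_def Let_def proj_V_typing
    using assoc comm unit s tangent_pullback_0[OF V2_pullback] zero_V(1)
    by (intro conjI allI impI) (blast | simp add: hom_iff)+
qed

lemma lift_V_T_proj: "lift V \<cdot> Tar X (proj V) = proj V \<cdot> tz X E"
  using extend_right[OF V_iota(3), of "Tar X (tp X E)"] by (simp add: proj_V tl_Tp)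

lemma lift_V_tp: "lift V \<cdot> tp X (Dom X \<iota>) = proj V \<cdot> zero V"
proof -
  have "(lift V \<cdot> tp X (Dom X \<iota>)) \<cdot> \<iota> = (lift V \<cdot> Tar X \<iota>) \<cdot> tp X (Tob X E)"
    using tp_natural[of \<iota>] by simp
  also have "\<dots> = (proj V \<cdot> zero V) \<cdot> \<iota>"
    unfolding V_iota(3) using tl_tp[of E] by (simp add: V_iota(1)) (simp add: proj_V)
  finally show ?thesis by (rule monicD[OF iota_monic(1)]) simp_all
qed

lemma T_V_fibred_sum [simp]: "fibred_sum (T_additive X V)"
  by (rule fibred_sum_T) (simp_all add: V2_pullback)

lemma bsum_T_V_iota:
  assumes "u \<in> Arr X" "v \<in> Arr X" "Dom X v = Dom X u"
    "Cod X u = Tob X (Dom X \<iota>)" "Cod X v = Tob X (Dom X \<iota>)"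
    "u \<cdot> Tar X (proj V) = v \<cdot> Tar X (proj V)"
  shows "bsum X (T_additive X V) u v \<cdot> Tar X \<iota>
    = bsum X (T_additive X (tangent_bundle X E)) (u \<cdot> Tar X \<iota>) (v \<cdot> Tar X \<iota>)"
proof (rule bsum_comp_morphism(1))
  show "bundle_morphism X (T_additive X V) (T_additive X (tangent_bundle X E))
      (Ident X (Tob X E)) (Tar X \<iota>)"
    by (simp add: bundle_morphism_def hom_iff) (simp add: proj_V)
  have "Tar X (plus V \<cdot> \<iota>) = bsum X (T_additive X (tangent_bundle X E))
      (Tar X (pr1 V \<cdot> \<iota>)) (Tar X (pr2 V \<cdot> \<iota>))"
    unfolding V_iota(2) by (rule Tar_bsum) (use pr_V_iota T2_pullback in simp_all)
  then show "plus (T_additive X V) \<cdot> Tar X \<iota> = bsum X (T_additive X (tangent_bundle X E))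
      (pr1 (T_additive X V) \<cdot> Tar X \<iota>) (pr2 (T_additive X V) \<cdot> Tar X \<iota>)"
    by simp
qed (use assms in simp_all)

lemma pr_V_lift:
  "(pr1 V \<cdot> lift V) \<cdot> Tar X (proj V) = (pr2 V \<cdot> lift V) \<cdot> Tar X (proj V)"
  "(pr1 V \<cdot> lift V) \<cdot> tp X (Dom X \<iota>) = (pr2 V \<cdot> lift V) \<cdot> tp X (Dom X \<iota>)"
  using extend_right[OF pr_V, of "tz X E"] extend_right[OF pr_V, of "zero V"]
  by (simp_all add: lift_V_T_proj lift_V_tp)

lemma lift_V_additive_T: "additive_morphism X V (T_additive X V) (tz X E) (lift V)"
proof -
  have "zero V \<cdot> lift V = tz X E \<cdot> Tar X (zero V)"
  proof (rule monicD[OF iota_monic(2)])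
    have "(tz X E \<cdot> Tar X (zero V)) \<cdot> Tar X \<iota> = tz X E \<cdot> Tar X (zero V \<cdot> \<iota>)" by simp
    then show "(zero V \<cdot> lift V) \<cdot> Tar X \<iota> = (tz X E \<cdot> Tar X (zero V)) \<cdot> Tar X \<iota>"
      unfolding V_iota(1) using extend_right[OF V_iota(1), of "tl X E"]
      by (simp add: V_iota(3) tz_tl tz_Tz)
  qed simp_all
  moreover have "plus V \<cdot> lift V = bsum X (T_additive X V) (pr1 V \<cdot> lift V) (pr2 V \<cdot> lift V)"
  proof (rule monicD[OF iota_monic(2)])
    have "(plus V \<cdot> lift V) \<cdot> Tar X \<iota> = (plus V \<cdot> \<iota>) \<cdot> tl X E"
      by (simp add: V_iota(3))
    also have "\<dots> = bsum X (T_additive X (tangent_bundle X E)) ((pr1 V \<cdot> \<iota>) \<cdot> tl X E) ((pr2 V \<cdot> \<iota>) \<cdot> tl X E)"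
      unfolding V_iota(2) by (rule bsum_tl_T) (use pr_V_iota in simp_all)
    also have "\<dots> = bsum X (T_additive X V) (pr1 V \<cdot> lift V) (pr2 V \<cdot> lift V) \<cdot> Tar X \<iota>"
      using bsum_T_V_iota[of "pr1 V \<cdot> lift V" "pr2 V \<cdot> lift V"] pr_V_lift by (simp add: V_iota(3))
    finally show "(plus V \<cdot> lift V) \<cdot> Tar X \<iota> =
      bsum X (T_additive X V) (pr1 V \<cdot> lift V) (pr2 V \<cdot> lift V) \<cdot> Tar X \<iota>" .
  qed (use bsum[of "T_additive X V" "pr1 V \<cdot> lift V" "pr2 V \<cdot> lift V"] pr_V_lift in simp_all)
  ultimately show ?thesis
    by (simp add: additive_morphism_def bundle_morphism_def hom_iff lift_V_T_proj)
qed

lemma lift_V_additive_tp: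
  "additive_morphism X V (tangent_bundle X (Dom X \<iota>)) (zero V) (lift V)"
proof -
  have "zero V \<cdot> lift V = zero V \<cdot> tz X (Dom X \<iota>)"
  proof (rule monicD[OF iota_monic(2)])
    have "(zero V \<cdot> tz X (Dom X \<iota>)) \<cdot> Tar X \<iota> = (zero V \<cdot> \<iota>) \<cdot> tz X (Tob X E)"
      using tz_natural[of \<iota>] by simp
    then show "(zero V \<cdot> lift V) \<cdot> Tar X \<iota> = (zero V \<cdot> tz X (Dom X \<iota>)) \<cdot> Tar X \<iota>"
      unfolding V_iota(1) using extend_right[OF V_iota(1), of "tl X E"]
      by (simp add: V_iota(3) tz_tl)
  qed simp_all
  moreover have "plus V \<cdot> lift V = bsum X (tangent_bundle X (Dom X \<iota>)) (pr1 V \<cdot> lift V) (pr2 V \<cdot> lift V)"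
  proof (rule monicD[OF iota_monic(2)])
    have "(plus V \<cdot> lift V) \<cdot> Tar X \<iota> = (plus V \<cdot> \<iota>) \<cdot> tl X E"
      by (simp add: V_iota(3))
    also have "\<dots> = bsum X (tangent_bundle X (Tob X E)) ((pr1 V \<cdot> \<iota>) \<cdot> tl X E) ((pr2 V \<cdot> \<iota>) \<cdot> tl X E)"
      unfolding V_iota(2) by (rule bsum_tl) (use pr_V_iota in simp_all)
    also have "\<dots> = bsum X (tangent_bundle X (Dom X \<iota>)) (pr1 V \<cdot> lift V) (pr2 V \<cdot> lift V) \<cdot> Tar X \<iota>"
      using tangent_bsum_comp_Tar[of \<iota> "pr1 V \<cdot> lift V" "pr2 V \<cdot> lift V"] pr_V_lift
      by (simp add: V_iota(3))
    finally show "(plus V \<cdot> lift V) \<cdot> Tar X \<iota> =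
      bsum X (tangent_bundle X (Dom X \<iota>)) (pr1 V \<cdot> lift V) (pr2 V \<cdot> lift V) \<cdot> Tar X \<iota>" .
  qed (use bsum[of "tangent_bundle X (Dom X \<iota>)" "pr1 V \<cdot> lift V" "pr2 V \<cdot> lift V"] pr_V_lift in simp_all)
  ultimately show ?thesis
    by (simp add: additive_morphism_def bundle_morphism_def hom_iff lift_V_tp)
qed

lemma lift_V_monic: "monic (lift V)"
  unfolding monic_def
proof (intro conjI allI impI; (elim conjE)?)
  fix u v
  assume uv: "u \<in> Arr X" "v \<in> Arr X" "Dom X u = Dom X v" "Cod X u = Dom X (lift V)"
    "Cod X v = Dom X (lift V)" "u \<cdot> lift V = v \<cdot> lift V"
  have "(u \<cdot> \<iota>) \<cdot> tl X E = (v \<cdot> \<iota>) \<cdot> tl X E"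
    using extend_right[OF uv(6), of "Tar X \<iota>"] uv(1-5) by (simp add: V_iota(3))
  then have "u \<cdot> \<iota> = v \<cdot> \<iota>"
    by (rule monicD[OF tl_monic[OF q_typing(4)]]) (use uv in simp_all)
  then show "u = v"
    by (rule monicD[OF iota_monic(1)]) (use uv in simp_all)
qed simp

lemma lift_V_lift: "lift V \<cdot> tl X (Dom X \<iota>) = lift V \<cdot> Tar X (lift V)"
proof (rule monicD[OF iota_monic(3)])
  have "(lift V \<cdot> tl X (Dom X \<iota>)) \<cdot> Tar X (Tar X \<iota>) = (lift V \<cdot> Tar X \<iota>) \<cdot> tl X (Tob X E)"
    using tl_natural[of \<iota>] by simp
  also have "\<dots> = (\<iota> \<cdot> tl X E) \<cdot> Tar X (tl X E)"
    unfolding V_iota(3) by (simp add: tl_tl)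
  also have "\<dots> = lift V \<cdot> Tar X (\<iota> \<cdot> tl X E)"
    using extend_right[OF V_iota(3), of "Tar X (tl X E)"] by simp
  also have "\<dots> = (lift V \<cdot> Tar X (lift V)) \<cdot> Tar X (Tar X \<iota>)"
    by (simp flip: V_iota(3))
  finally show "(lift V \<cdot> tl X (Dom X \<iota>)) \<cdot> Tar X (Tar X \<iota>) =
    (lift V \<cdot> Tar X (lift V)) \<cdot> Tar X (Tar X \<iota>)" .
qed simp_all

lemmas comp_lift_xi_V =
  comp_lift_xi[OF V_fibred_sum V2_pullback, simplified, OF lift_V_T_proj]

lemmas comp_lift_xi_E = comp_lift_xi_tangent[of E, simplified T2_pullback tl_Tp q_typing, simplified]

text \<open>This is naturality of \<open>\<xi>\<close> along \<open>\<iota>\<^sub>q\<close>, which preserves sums, lifts and zeros; \<open>x\<close> is \<open>y\<close>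
  followed by \<open>\<iota>\<^sub>q \<times> \<iota>\<^sub>q\<close>. It compares the square for the lift of \<open>Vq\<close> with that for \<open>l\<^sub>E\<close>.\<close>

lemma lift_xi_V_T_iota:
  assumes "y \<in> Arr X" "Cod X y = Dom X (pr1 V)"
    and x: "x = pair X (tpr1 X E) (tpr2 X E) (y \<cdot> (pr1 V \<cdot> \<iota>)) (y \<cdot> (pr2 V \<cdot> \<iota>))"
  shows "x \<in> Arr X" "Dom X x = Dom X y" "Cod X x = Dom X (tpr1 X E)"
    "x \<cdot> tpr1 X E = y \<cdot> (pr1 V \<cdot> \<iota>)" "x \<cdot> tpr2 X E = y \<cdot> (pr2 V \<cdot> \<iota>)"
    "(y \<cdot> lift_xi X V) \<cdot> Tar X \<iota> = x \<cdot> lift_xi X (tangent_bundle X E)"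
proof -
  note S = fibred_sumD[OF tangent_fibred_sum[of E], simplified]
  note pb = is_pullbackD[OF S(1)]
  have e: "(y \<cdot> (pr1 V \<cdot> \<iota>)) \<cdot> tp X E = (y \<cdot> (pr2 V \<cdot> \<iota>)) \<cdot> tp X E"
    using pr_V_iota assms(1,2) by simp
  show p: "x \<in> Arr X" "Dom X x = Dom X y" "Cod X x = Dom X (tpr1 X E)"
    "x \<cdot> tpr1 X E = y \<cdot> (pr1 V \<cdot> \<iota>)" "x \<cdot> tpr2 X E = y \<cdot> (pr2 V \<cdot> \<iota>)"
    using pair[OF S(1), of "y \<cdot> (pr1 V \<cdot> \<iota>)" "y \<cdot> (pr2 V \<cdot> \<iota>)"] e assms(1,2) unfolding x by simp_all
  have c1: "x \<cdot> (tpr1 X E \<cdot> tl X E) = (y \<cdot> (pr1 V \<cdot> lift V)) \<cdot> Tar X \<iota>"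
    using extend_right[OF p(4), of "tl X E"] p pb assms(1,2) by (simp add: V_iota(3))
  have c2: "x \<cdot> (tpr2 X E \<cdot> tz X (Tob X E)) = (y \<cdot> (pr2 V \<cdot> tz X (Dom X \<iota>))) \<cdot> Tar X \<iota>"
    using extend_right[OF p(5), of "tz X (Tob X E)"] p pb assms(1,2) tz_natural[of \<iota>] by simp
  have e': "(y \<cdot> (pr1 V \<cdot> lift V)) \<cdot> Tar X (proj V) = (y \<cdot> (pr2 V \<cdot> tz X (Dom X \<iota>))) \<cdot> Tar X (proj V)"
    using extend_right[OF pr_V, of "tz X E"] assms(1,2) tz_natural[of "proj V"]
    by (simp add: lift_V_T_proj)
  have "(y \<cdot> lift_xi X V) \<cdot> Tar X \<iota> = bsum X (T_additive X (tangent_bundle X E))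
    ((y \<cdot> (pr1 V \<cdot> lift V)) \<cdot> Tar X \<iota>) ((y \<cdot> (pr2 V \<cdot> tz X (Dom X \<iota>))) \<cdot> Tar X \<iota>)"
    unfolding comp_lift_xi_V(5)[OF assms(1,2)]
    by (rule bsum_T_V_iota) (use e' assms(1,2) in simp_all)
  also have "\<dots> = x \<cdot> lift_xi X (tangent_bundle X E)"
    unfolding c1[symmetric] c2[symmetric] using comp_lift_xi_E(5)[OF p(1,3)] by simp
  finally show "(y \<cdot> lift_xi X V) \<cdot> Tar X \<iota> = x \<cdot> lift_xi X (tangent_bundle X E)" .
qed

text \<open>Universality is inherited from the tangent bundle of \<open>E\<close>: a cone \<open>(u, v)\<close> gives \<open>(u T\<iota>, v)\<close>,
  which factors through \<open>\<xi>\<close> by some \<open>\<langle>w\<^sub>1, w\<^sub>2\<rangle>\<close>, and both components are vertical. For \<open>w\<^sub>2\<close> this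
  holds because \<open>\<xi> p = \<pi>\<^sub>2\<close>, so that \<open>w\<^sub>2 = u p \<iota>\<close>. Applying \<open>T\<^sup>2q\<close> to \<open>u T\<iota> = \<langle>w\<^sub>1, w\<^sub>2\<rangle> \<xi>\<close> then shows that
  \<open>w\<^sub>1 Tq l\<close> is a zero followed by \<open>l\<close>, and \<open>l\<close> is monic.\<close>

lemma V_universal: "universal_lift X V"
proof -
  let ?T = "tangent_bundle X E" and ?Vq = "Dom X \<iota>"
  note SE = fibred_sumD[OF tangent_fibred_sum[of E], simplified]
  note pb = is_pullbackD[OF SE(1)]
  have UE: "is_pullback X (lift_xi X ?T) (tpr1 X E \<cdot> tp X E) (Tar X (tp X E)) (tz X E)"
    using tangent_pullback_0 tl_universal[of E] by (simp add: universal_lift_def)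
  have "is_pullback X (lift_xi X V) (pr1 V \<cdot> proj V) (Tar X (proj V)) (tz X E)"
  proof (rule is_pullbackI)
    fix u v
    assume uv: "u \<in> Arr X" "v \<in> Arr X" "Dom X v = Dom X u" "Cod X u = Dom X (Tar X (proj V))"
      "Cod X v = Dom X (tz X E)" "u \<cdot> Tar X (proj V) = v \<cdot> tz X E"
    have uv': "Cod X u = Tob X ?Vq" "Cod X v = E" using uv by simp_all
    have "(u \<cdot> Tar X \<iota>) \<cdot> Tar X (tp X E) = v \<cdot> tz X E"
      using uv uv' by (simp add: proj_V)
    then obtain w where w: "w \<in> Arr X" "Dom X w = Dom X u" "Cod X w = Dom X (tpr1 X E)"
      "w \<cdot> lift_xi X ?T = u \<cdot> Tar X \<iota>" "w \<cdot> (tpr1 X E \<cdot> tp X E) = v"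
      using pair[OF UE, of "u \<cdot> Tar X \<iota>" v] uv uv' comp_lift_xi_E(2) by simp
    define w1 where "w1 = w \<cdot> tpr1 X E"
    define w2 where "w2 = w \<cdot> tpr2 X E"
    have wi: "w1 \<in> Arr X" "Dom X w1 = Dom X u" "Cod X w1 = Tob X E" "w1 \<cdot> tp X E = v"
      "w2 \<in> Arr X" "Dom X w2 = Dom X u" "Cod X w2 = Tob X E" "w2 \<cdot> tp X E = v"
      using w pb by (simp_all add: w1_def w2_def)
    have xi: "u \<cdot> Tar X \<iota> = bsum X (T_additive X ?T) (w1 \<cdot> tl X E) (w2 \<cdot> tz X (Tob X E))"
      using comp_lift_xi_E(5)[of w] w pb by (simp add: w1_def w2_def)
    have c: "(w1 \<cdot> tl X E) \<cdot> Tar X (tp X E) = (w2 \<cdot> tz X (Tob X E)) \<cdot> Tar X (tp X E)"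
      using extend_right[OF wi(4), of "tz X E"] extend_right[OF wi(8), of "tz X E"] wi uv'
        tz_natural[of "tp X E"] by (simp add: tl_Tp)
    have w2: "w2 = (u \<cdot> tp X ?Vq) \<cdot> \<iota>"
    proof -
      have "(u \<cdot> tp X ?Vq) \<cdot> \<iota> = (u \<cdot> Tar X \<iota>) \<cdot> tp X (Tob X E)"
        using tp_natural[of \<iota>] uv uv' by simp
      also have "\<dots> = bsum X ?T ((w1 \<cdot> tl X E) \<cdot> tp X (Tob X E)) ((w2 \<cdot> tz X (Tob X E)) \<cdot> tp X (Tob X E))"
        unfolding xi using bsum_T_comp_tp[of ?T "w1 \<cdot> tl X E" "w2 \<cdot> tz X (Tob X E)"] c wi
        by (simp add: T2_pullback)
      also have "\<dots> = bsum X ?T (v \<cdot> tz X E) w2"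
        using extend_right[OF wi(4), of "tz X E"] wi uv uv' by (simp add: tl_tp tz_tp)
      also have "\<dots> = w2"
        using bsum_zero(2)[OF tp_additive[of E], of w2 v] wi by simp
      finally show ?thesis by simp
    qed
    define k where "k = (u \<cdot> tp X ?Vq) \<cdot> tV"
    have k: "k \<in> Arr X" "Dom X k = Dom X u" "Cod X k = M"
      using uv uv' by (simp_all add: k_def)
    have w2q: "w2 \<cdot> Tar X q = k \<cdot> tz X M"
      unfolding w2 k_def using uv uv' by (simp add: iota_Tq)
    have vq: "v \<cdot> q = k"
    proof -
      have "v \<cdot> q = (w2 \<cdot> Tar X q) \<cdot> tp X M"
        using extend_right[OF wi(8), of q] wi uv uv' tp_natural[of q] by simp
      then show ?thesis unfolding w2q using k by (simp add: tz_tp)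
    qed
    have w1qp: "w1 \<cdot> (Tar X q \<cdot> tp X M) = k"
      using extend_right[OF wi(4), of q] wi uv uv' tp_natural[of q] vq by simp
    have w1q: "w1 \<cdot> Tar X q = k \<cdot> tz X M"
    proof -
      \<comment> \<open>After \<open>T\<^sup>2q\<close> the second summand of \<open>u T\<iota>\<close> becomes a zero of the bundle \<open>Tp\<^sub>M\<close>, so only
        \<open>w\<^sub>1 Tq l\<close> is left.\<close>
      have "u \<cdot> (Tar X tV \<cdot> Tar X (tz X M)) = (u \<cdot> Tar X \<iota>) \<cdot> Tar X (Tar X q)"
        using uv uv' iota_Tq by (simp flip: Tar_comp')
      also have "\<dots> = bsum X (T_additive X (tangent_bundle X M))
          ((w1 \<cdot> tl X E) \<cdot> Tar X (Tar X q)) ((w2 \<cdot> tz X (Tob X E)) \<cdot> Tar X (Tar X q))"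
        unfolding xi using T_tangent_bsum_comp_Tar[of q "w1 \<cdot> tl X E" "w2 \<cdot> tz X (Tob X E)"] c wi
        by simp
      also have "(w1 \<cdot> tl X E) \<cdot> Tar X (Tar X q) = (w1 \<cdot> Tar X q) \<cdot> tl X M"
        using tl_natural[of q] wi by simp
      also have "(w2 \<cdot> tz X (Tob X E)) \<cdot> Tar X (Tar X q) = (k \<cdot> tz X M) \<cdot> Tar X (tz X M)"
      proof -
        have "(w2 \<cdot> tz X (Tob X E)) \<cdot> Tar X (Tar X q) = (w2 \<cdot> Tar X q) \<cdot> tz X (Tob X M)"
          using tz_natural[of "Tar X q"] wi by simp
        then show ?thesis unfolding w2q using k by (simp add: tz_Tz)
      qed
      also have "bsum X (T_additive X (tangent_bundle X M)) ((w1 \<cdot> Tar X q) \<cdot> tl X M)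
          ((k \<cdot> tz X M) \<cdot> Tar X (tz X M)) = (w1 \<cdot> Tar X q) \<cdot> tl X M"
      proof -
        have "w1 \<cdot> (Tar X q \<cdot> (tp X M \<cdot> tz X M)) = k \<cdot> tz X M"
          using extend_right[of w1 "Tar X q \<cdot> tp X M" k "tz X M"] w1qp wi by simp
        then show ?thesis
          using T_bsum_zero[OF tp_additive[of M], of "(w1 \<cdot> Tar X q) \<cdot> tl X M" "k \<cdot> tz X M"] wi
          by (simp add: T2_pullback tl_Tp)
      qed
      finally have *: "u \<cdot> (Tar X tV \<cdot> Tar X (tz X M)) = (w1 \<cdot> Tar X q) \<cdot> tl X M" .
      \<comment> \<open>Applying \<open>Tp\<^sub>M\<close> identifies \<open>u T(T\<^sup>Vq)\<close> itself as a zero, and zeros satisfy \<open>z Tz = z l\<close>.\<close>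
      have "(u \<cdot> (Tar X tV \<cdot> Tar X (tz X M))) \<cdot> Tar X (tp X M) = u \<cdot> Tar X tV"
        using uv uv' by (simp add: tz_tp flip: Tar_comp')
      moreover have "((w1 \<cdot> Tar X q) \<cdot> tl X M) \<cdot> Tar X (tp X M) = k \<cdot> tz X M"
        using extend_right[of w1 "Tar X q \<cdot> tp X M" k "tz X M"] w1qp wi by (simp add: tl_Tp)
      ultimately have t: "u \<cdot> Tar X tV = k \<cdot> tz X M" unfolding * by simp
      have "(w1 \<cdot> Tar X q) \<cdot> tl X M = (k \<cdot> tz X M) \<cdot> tl X M"
        unfolding *[symmetric] using extend_right[OF t, of "Tar X (tz X M)"] uv uv' k
        by (simp add: tz_tl tz_Tz)
      then show ?thesis
        by (rule monicD[OF tl_monic[OF q_typing(5)]]) (use wi k in simp_all)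
    qed
    define y1 where "y1 = pair X \<iota> tV w1 k"
    have y1: "y1 \<in> Arr X" "Dom X y1 = Dom X u" "Cod X y1 = ?Vq" "y1 \<cdot> \<iota> = w1"
      using pair[OF tangent_pullback_0[OF V_pullback], of w1 k] wi k w1q by (simp_all add: y1_def)
    have y1p: "y1 \<cdot> proj V = v"
      using extend_right[OF y1(4), of "tp X E"] y1 wi by (simp add: proj_V)
    have y2p: "(u \<cdot> tp X ?Vq) \<cdot> proj V = v"
      using wi(8) uv uv' unfolding w2 by (simp add: proj_V)
    define y where "y = pair X (pr1 V) (pr2 V) y1 (u \<cdot> tp X ?Vq)"
    have y: "y \<in> Arr X" "Dom X y = Dom X u" "Cod X y = Dom X (pr1 V)" "y \<cdot> pr1 V = y1"
      "y \<cdot> pr2 V = u \<cdot> tp X ?Vq"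
      using pair[OF tangent_pullback_0[OF V2_pullback], of y1 "u \<cdot> tp X ?Vq"] y1 y1p y2p uv uv'
      by (simp_all add: y_def)
    have yi: "y \<cdot> (pr1 V \<cdot> \<iota>) = w1" "y \<cdot> (pr2 V \<cdot> \<iota>) = w2"
      using extend_right[OF y(4), of \<iota>] extend_right[OF y(5), of \<iota>] y y1 w2 uv uv' by simp_all
    have "pair X (tpr1 X E) (tpr2 X E) (y \<cdot> (pr1 V \<cdot> \<iota>)) (y \<cdot> (pr2 V \<cdot> \<iota>)) = w"
      by (rule pair_eqI[OF SE(1)]) (use w in \<open>simp_all add: yi w1_def w2_def\<close>)
    then have "(y \<cdot> lift_xi X V) \<cdot> Tar X \<iota> = u \<cdot> Tar X \<iota>"
      using lift_xi_V_T_iota(6)[OF y(1,3) refl] w(4) by simp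
    then have "y \<cdot> lift_xi X V = u"
      by (rule monicD[OF iota_monic(2)]) (use y uv uv' comp_lift_xi_V(1-3) in simp_all)
    moreover have "y \<cdot> (pr1 V \<cdot> proj V) = v"
      using extend_right[OF y(4), of "proj V"] y y1p by simp
    ultimately show "\<exists>y. y \<in> Arr X \<and> Dom X y = Dom X u \<and> Cod X y = Dom X (lift_xi X V) \<and>
        y \<cdot> lift_xi X V = u \<and> y \<cdot> (pr1 V \<cdot> proj V) = v"
      using y comp_lift_xi_V(2) by (intro exI[of _ y]) simp
  next
    fix y y'
    assume y: "y \<in> Arr X" "y' \<in> Arr X" "Dom X y = Dom X y'" "Cod X y = Dom X (lift_xi X V)"
      "Cod X y' = Dom X (lift_xi X V)" "y \<cdot> lift_xi X V = y' \<cdot> lift_xi X V"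
      "y \<cdot> (pr1 V \<cdot> proj V) = y' \<cdot> (pr1 V \<cdot> proj V)"
    have c: "Cod X y = Dom X (pr1 V)" "Cod X y' = Dom X (pr1 V)"
      using y comp_lift_xi_V(2) by simp_all
    define x where "x = pair X (tpr1 X E) (tpr2 X E) (y \<cdot> (pr1 V \<cdot> \<iota>)) (y \<cdot> (pr2 V \<cdot> \<iota>))"
    define x' where "x' = pair X (tpr1 X E) (tpr2 X E) (y' \<cdot> (pr1 V \<cdot> \<iota>)) (y' \<cdot> (pr2 V \<cdot> \<iota>))"
    note X = lift_xi_V_T_iota[OF y(1) c(1) x_def] and X' = lift_xi_V_T_iota[OF y(2) c(2) x'_def]
    have xp: "x \<cdot> (tpr1 X E \<cdot> tp X E) = x' \<cdot> (tpr1 X E \<cdot> tp X E)"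
      using extend_right[OF X(4), of "tp X E"] extend_right[OF X'(4), of "tp X E"] X(1-3) X'(1-3) pb
        y(1,2,7) c by (simp add: proj_V)
    have xxi: "x \<cdot> lift_xi X ?T = x' \<cdot> lift_xi X ?T"
      unfolding X(6)[symmetric] X'(6)[symmetric] y(6) ..
    have "x = x'"
      by (rule pullback_ext[OF UE]) (use xp xxi X(1-3) X'(1-3) y(3) comp_lift_xi_E(2) in simp_all)
    then have i: "(y \<cdot> pr1 V) \<cdot> \<iota> = (y' \<cdot> pr1 V) \<cdot> \<iota>" "(y \<cdot> pr2 V) \<cdot> \<iota> = (y' \<cdot> pr2 V) \<cdot> \<iota>"
      using X(4,5) X'(4,5) y(1,2) c by simp_all
    have "y \<cdot> pr1 V = y' \<cdot> pr1 V"
      by (rule monicD[OF iota_monic(1) i(1)]) (use y(1-3) c in simp_all)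
    moreover have "y \<cdot> pr2 V = y' \<cdot> pr2 V"
      by (rule monicD[OF iota_monic(1) i(2)]) (use y(1-3) c in simp_all)
    ultimately show "y = y'"
      using pullback_ext[OF tangent_pullback_0[OF V2_pullback] y(1-3) c] by simp
  qed (use comp_lift_xi_V(1-4) in simp_all)
  moreover obtain a b where "tangent_pullback X a b (Tar X (proj V)) (tz X E)"
    using display_pullback_T[OF V_display, of "tz X E"] by auto
  ultimately have "tangent_pullback X (lift_xi X V) (pr1 V \<cdot> proj V) (Tar X (proj V)) (tz X E)"
    by (rule tangent_pullback_unique[rotated])
  then show ?thesis by (simp add: universal_lift_def)
qed

lemma V_in_DB: "V \<in> DB X E"
  unfolding DB_def differential_bundle_def Let_def
  using V_display display_tangent_fibre_powers[OF V_display] V2_pullback V_additive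
    lift_V_additive_T lift_V_additive_tp lift_V_lift V_universal
  by (simp add: hom_iff)

end


section \<open>Vertical connections\<close>

context vertical_setting
begin

lemma linear_over_tangent_iff:
  assumes "B = tangent_bundle X E"
  shows "linear_over X E B C f \<longleftrightarrow> Cod X (proj C) = E \<and> f \<in> hom X (Tob X E) (Dom X (proj C)) \<and>
    f \<cdot> proj C = tp X E \<and> f \<cdot> lift C = tl X E \<cdot> Tar X f"
  unfolding assms
  by (auto simp: linear_over_def linear_morphism_def bundle_morphism_def hom_iff)

lemma vertical_connectionD:
  assumes "vertical_connection X q V \<iota> R"
  shows "R \<in> Arr X" "Dom X R = Tob X E" "Cod X R = Dom X \<iota>" "\<iota> \<cdot> R = Ident X (Dom X \<iota>)"
    "R \<cdot> proj V = tp X E" "R \<cdot> lift V = tl X E \<cdot> Tar X R"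
    "linear_over X E (tangent_bundle X E) V R"
  using assms by (auto simp: vertical_connection_def linear_over_tangent_iff hom_iff)

lemma vertical_connection_tV:
  assumes "vertical_connection X q V \<iota> R"
  shows "R \<cdot> tV = Tar X q \<cdot> tp X M"
proof -
  note R = vertical_connectionD[OF assms]
  have "R \<cdot> (proj V \<cdot> q) = tp X E \<cdot> q"
    by (rule extend_right[OF R(5)]) (use R(1-3) in simp_all)
  then show ?thesis using tp_natural[of q] by (simp add: proj_V_q)
qed

lemma bsum_vertical_connection:
  assumes "vertical_connection X q V \<iota> R"
    and "u \<in> Arr X" "v \<in> Arr X" "Dom X v = Dom X u" "Cod X u = Tob X E" "Cod X v = Tob X E"
      "u \<cdot> tp X E = v \<cdot> tp X E"
  shows "bsum X (tangent_bundle X E) u v \<cdot> R = bsum X V (u \<cdot> R) (v \<cdot> R)"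
proof -
  note R = vertical_connectionD[OF assms(1)]
  have lin: "linear_morphism X (tangent_bundle X E) V (Ident X E) R"
    using R(7) by (simp add: linear_over_def)
  have "plus (tangent_bundle X E) \<cdot> R =
      bsum X V (pr1 (tangent_bundle X E) \<cdot> R) (pr2 (tangent_bundle X E) \<cdot> R)"
    by (rule linear_imp_additive[OF _ _ _ _ _ lin])
      (use tl_additive_tp[of E] lift_V_additive_tp lift_V_monic in simp_all)
  then show ?thesis
    using lin assms(2-7)
    by (intro bsum_comp_morphism(1)[where f = "Ident X E"]) (simp_all add: linear_morphism_def)
qed

text \<open>Pasting the square of \<open>R\<close> with the square defining \<open>Vq\<close> gives the square of \<open>R \<iota>\<^sub>q\<close>. So fullness
  of \<open>R\<close> and the pullback condition on its connection form are the same condition.\<close>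

lemma full_vertical_connection_iff:
  assumes "vertical_connection X q V \<iota> R"
  shows "full_vertical_connection X q V \<iota> tV R \<longleftrightarrow>
    tangent_pullback X (R \<cdot> \<iota>) (Tar X q) (Tar X q) (tp X M \<cdot> tz X M)"
  using tangent_pullback_paste_iff[OF V_pullback, of R "Tar X q" "tp X M"]
    vertical_connectionD[OF assms] vertical_connection_tV[OF assms] assms
  by (simp add: full_vertical_connection_def)

lemma abstract_imp_full:
  assumes "abstract_vertical_connection X q \<phi>"
  obtains R where "full_vertical_connection X q V \<iota> tV R" "R \<cdot> \<iota> = \<phi>"
proof -
  have phi: "\<phi> \<in> Arr X" "Dom X \<phi> = Tob X E" "Cod X \<phi> = Tob X E" "\<phi> \<cdot> \<phi> = \<phi>"
    "\<phi> \<cdot> tp X E = tp X E" "\<phi> \<cdot> tl X E = tl X E \<cdot> Tar X \<phi>"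
    and P: "tangent_pullback X \<phi> (Tar X q) (Tar X q) (tp X M \<cdot> tz X M)"
    using assms
    by (simp_all add: abstract_vertical_connection_def Let_def linear_over_tangent_iff hom_iff)
  note P0 = tangent_pullback_0[OF P]
  have c: "\<phi> \<cdot> Tar X q = (Tar X q \<cdot> tp X M) \<cdot> tz X M"
    using is_pullbackD(9)[OF P0] by simp
  define R where "R = pair X \<iota> tV \<phi> (Tar X q \<cdot> tp X M)"
  have R: "R \<in> Arr X" "Dom X R = Tob X E" "Cod X R = Dom X \<iota>" "R \<cdot> \<iota> = \<phi>"
    using pair[OF tangent_pullback_0[OF V_pullback] _ _ _ _ _ c] phi by (simp_all add: R_def)
  \<comment> \<open>\<open>(\<iota>, T\<^sup>Vq z)\<close> is a cone over the cospan of the \<open>\<phi>\<close>-square, so \<open>\<iota>\<close> factors through \<open>\<phi>\<close>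
    and is fixed by the idempotent \<open>\<phi>\<close>.\<close>
  have "\<iota> \<cdot> Tar X q = (tV \<cdot> tz X M) \<cdot> (tp X M \<cdot> tz X M)"
    using extend_right[OF tz_tp[of M], of "tz X M"] by (simp add: iota_Tq)
  then obtain w where w: "w \<in> Arr X" "Dom X w = Dom X \<iota>" "Cod X w = Tob X E" "w \<cdot> \<phi> = \<iota>"
    using pair[OF P0, of \<iota> "tV \<cdot> tz X M"] phi by simp
  have fix_iota: "\<iota> \<cdot> \<phi> = \<iota>"
  proof -
    have "\<iota> \<cdot> \<phi> = w \<cdot> (\<phi> \<cdot> \<phi>)"
      using extend_right[OF w(4), of \<phi>] w phi(1-3) by simp
    then show ?thesis using phi(4) w(4) by simp
  qed
  have "\<iota> \<cdot> R = Ident X (Dom X \<iota>)"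
  proof (rule monicD[OF iota_monic(1)])
    show "(\<iota> \<cdot> R) \<cdot> \<iota> = Ident X (Dom X \<iota>) \<cdot> \<iota>" using R fix_iota by simp
  qed (use R in simp_all)
  moreover have "R \<cdot> proj V = tp X E"
    using extend_right[OF R(4), of "tp X E"] R phi by (simp add: proj_V)
  moreover have "R \<cdot> lift V = tl X E \<cdot> Tar X R"
  proof (rule monicD[OF iota_monic(2)])
    have "(R \<cdot> lift V) \<cdot> Tar X \<iota> = \<phi> \<cdot> tl X E"
      using extend_right[OF R(4), of "tl X E"] R by (simp add: V_iota(3))
    also have "\<dots> = tl X E \<cdot> Tar X (R \<cdot> \<iota>)" unfolding R(4) by (rule phi(6))
    also have "\<dots> = (tl X E \<cdot> Tar X R) \<cdot> Tar X \<iota>" using R(1-3) by simp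
    finally show "(R \<cdot> lift V) \<cdot> Tar X \<iota> = (tl X E \<cdot> Tar X R) \<cdot> Tar X \<iota>" .
  qed (use R in simp_all)
  ultimately have "vertical_connection X q V \<iota> R"
    using R by (simp add: vertical_connection_def linear_over_tangent_iff hom_iff)
  then have "full_vertical_connection X q V \<iota> tV R"
    using full_vertical_connection_iff P R(4) by simp
  then show ?thesis using that R(4) by blast
qed

lemma full_imp_split_abstract:
  assumes "full_vertical_connection X q V \<iota> tV R"
  shows "split_abstract_vertical_connection X q (R \<cdot> \<iota>)"
proof -
  have vc: "vertical_connection X q V \<iota> R"
    using assms by (simp add: full_vertical_connection_def)
  note R = vertical_connectionD[OF vc]
  have idem: "(R \<cdot> \<iota>) \<cdot> (R \<cdot> \<iota>) = R \<cdot> \<iota>"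
    using extend_right[OF R(4), of \<iota>] R(1-3) by simp
  have tp: "(R \<cdot> \<iota>) \<cdot> tp X E = tp X E"
    using R by (simp add: proj_V)
  have tl: "(R \<cdot> \<iota>) \<cdot> tl X E = tl X E \<cdot> Tar X (R \<cdot> \<iota>)"
  proof -
    have "(R \<cdot> \<iota>) \<cdot> tl X E = (R \<cdot> lift V) \<cdot> Tar X \<iota>"
      using R(1-3) by (simp add: V_iota(3))
    also have "\<dots> = tl X E \<cdot> Tar X (R \<cdot> \<iota>)"
      unfolding R(6) using R(1-3) by simp
    finally show ?thesis .
  qed
  have "abstract_vertical_connection X q (R \<cdot> \<iota>)"
    using full_vertical_connection_iff[OF vc] assms idem tp tl R(1-3)
    by (simp add: abstract_vertical_connection_def Let_def linear_over_tangent_iff hom_iff)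
  moreover have "linear_over X E V (tangent_bundle X E) \<iota>"
    by (simp add: linear_over_def linear_morphism_def bundle_morphism_def hom_iff V_iota(3))
      (simp add: proj_V)
  moreover have "\<iota> \<cdot> R = Ident X (Dom X (proj V))" using R(4) by simp
  ultimately show ?thesis
    using V_in_DB R(7) unfolding split_abstract_vertical_connection_def splits_in_DB_def q_typing
    by blast
qed

lemma split_abstract_iff_full:
  "split_abstract_vertical_connection X q \<phi> \<longleftrightarrow>
    (\<exists>R. full_vertical_connection X q V \<iota> tV R \<and> vertical_connection_form X \<iota> R = \<phi>)"
  using abstract_imp_full[of \<phi>] full_imp_split_abstract
  unfolding vertical_connection_form_def
  by (metis split_abstract_vertical_connection_def)

end


section \<open>Ehresmann connections\<close>

locale connection_setting = vertical_setting X q \<iota> tV E M V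
  for X :: "('o, 'm, 'x) tangent_data_scheme" (structure) and q \<iota> tV E M V +
  fixes F :: "'m bundle_data" and tF :: 'm
  assumes finsler: "finsler_bundle X q F tF"
begin

lemma F_pullback: "tangent_pullback X (proj F) tF q (tp X M)"
  using finsler by (simp add: finsler_bundle_def Let_def)

lemma F_typing [simp]:
  "proj F \<in> Arr X" "Dom X (proj F) = Dom X tF" "Cod X (proj F) = E"
  "tF \<in> Arr X" "Cod X tF = Tob X M"
  "lift F \<in> Arr X" "Dom X (lift F) = Dom X tF" "Cod X (lift F) = Tob X (Dom X tF)"
  using finsler is_pullbackD[OF tangent_pullback_0[OF F_pullback]]
  by (auto simp: finsler_bundle_def Let_def hom_iff)

lemma F_commutes: "proj F \<cdot> q = tF \<cdot> tp X M"
  using is_pullbackD[OF tangent_pullback_0[OF F_pullback]] by simp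

lemma lift_F:
  "lift F \<cdot> Tar X (proj F) = proj F \<cdot> tz X E" "lift F \<cdot> Tar X tF = tF \<cdot> tl X M"
  using finsler by (simp_all add: finsler_bundle_def Let_def)

abbreviation descent where "descent \<equiv> horizontal_descent X q F tF"

lemma descent [simp]:
  "descent \<in> Arr X" "Dom X descent = Tob X E" "Cod X descent = Dom X tF"
  and descent_proj: "descent \<cdot> proj F = tp X E" "descent \<cdot> tF = Tar X q"
  using pair[OF tangent_pullback_0[OF F_pullback], of "tp X E" "Tar X q"] tp_natural[of q]
  by (simp_all add: horizontal_descent_def)

text \<open>A full \<open>R\<close> makes \<open>TE\<close> the pullback of \<open>Vq\<close> and \<open>TM\<close> over \<open>M\<close>; the horizontal lift is the zero
  of \<open>Vq\<close> in the first coordinate. Equations into \<open>TE\<close> are then checked in the two coordinates \<open>R\<close>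
  and \<open>Tq\<close>.\<close>

lemma full_imp_ehresmann:
  assumes "full_vertical_connection X q V \<iota> tV R"
  obtains H where "ehresmann_connection X q V \<iota> F tF R H"
proof -
  have vc: "vertical_connection X q V \<iota> R"
    and P: "tangent_pullback X R (Tar X q) tV (tp X M)"
    using assms by (simp_all add: full_vertical_connection_def)
  note P0 = tangent_pullback_0[OF P] and P1 = tangent_pullback_1[OF P]
  note R = vertical_connectionD[OF vc]
  have c: "(proj F \<cdot> zero V) \<cdot> tV = tF \<cdot> tp X M"
    using F_commutes zero_V(2) by simp
  define H where "H = pair X R (Tar X q) (proj F \<cdot> zero V) tF"
  have H: "H \<in> Arr X" "Dom X H = Dom X tF" "Cod X H = Tob X E" "H \<cdot> R = proj F \<cdot> zero V"
    "H \<cdot> Tar X q = tF"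
    using pair[OF P0 _ _ _ _ _ c] R by (simp_all add: H_def)
  have Hp: "H \<cdot> tp X E = proj F"
  proof -
    have "H \<cdot> tp X E = (H \<cdot> R) \<cdot> proj V"
      using R H(1-3) by simp
    then show ?thesis unfolding H(4) by (simp add: zero_V)
  qed
  have "H \<cdot> descent = Ident X (Dom X tF)"
  proof (rule pullback_ext[OF tangent_pullback_0[OF F_pullback]])
    show "(H \<cdot> descent) \<cdot> proj F = Ident X (Dom X tF) \<cdot> proj F"
      "(H \<cdot> descent) \<cdot> tF = Ident X (Dom X tF) \<cdot> tF"
      using H Hp by (simp_all add: descent_proj)
  qed (use H in simp_all)
  moreover have "H \<cdot> tl X E = lift F \<cdot> Tar X H"
  proof (rule pullback_ext[OF P1])
    have "(H \<cdot> tl X E) \<cdot> Tar X R = (H \<cdot> R) \<cdot> lift V"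
      using R(1-3,6) H(1-3) by simp
    also have "\<dots> = (proj F \<cdot> tz X E) \<cdot> Tar X (zero V)"
    proof -
      have "zero V \<cdot> lift V = tz X E \<cdot> Tar X (zero V)"
        using lift_V_additive_T by (simp add: additive_morphism_def)
      then show ?thesis unfolding H(4) by simp
    qed
    also have "\<dots> = lift F \<cdot> Tar X (proj F \<cdot> zero V)"
      unfolding lift_F(1)[symmetric] by simp
    also have "\<dots> = (lift F \<cdot> Tar X H) \<cdot> Tar X R"
      unfolding H(4)[symmetric] using R(1-3) H(1-3) by simp
    finally show "(H \<cdot> tl X E) \<cdot> Tar X R = (lift F \<cdot> Tar X H) \<cdot> Tar X R" .
    have "(H \<cdot> tl X E) \<cdot> Tar X (Tar X q) = (H \<cdot> Tar X q) \<cdot> tl X M"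
      using tl_natural[of q] H(1-3) by simp
    also have "\<dots> = lift F \<cdot> Tar X tF"
      unfolding H(5) lift_F(2) ..
    also have "\<dots> = (lift F \<cdot> Tar X H) \<cdot> Tar X (Tar X q)"
      unfolding H(5)[symmetric] using H(1-3) by simp
    finally show "(H \<cdot> tl X E) \<cdot> Tar X (Tar X q) = (lift F \<cdot> Tar X H) \<cdot> Tar X (Tar X q)" .
  qed (use R H in simp_all)
  moreover have "bsum X (tangent_bundle X E) (R \<cdot> \<iota>) (descent \<cdot> H) = Ident X (Tob X E)"
  proof (rule pullback_ext[OF P0])
    let ?T = "tangent_bundle X E"
    have e: "(R \<cdot> \<iota>) \<cdot> tp X E = (descent \<cdot> H) \<cdot> tp X E"
      using R H Hp by (simp add: descent_proj proj_V)
    note b = bsum[of ?T "R \<cdot> \<iota>" "descent \<cdot> H"]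
    show "bsum X ?T (R \<cdot> \<iota>) (descent \<cdot> H) \<in> Arr X"
      "Dom X (bsum X ?T (R \<cdot> \<iota>) (descent \<cdot> H)) = Dom X (Ident X (Tob X E))"
      "Cod X (bsum X ?T (R \<cdot> \<iota>) (descent \<cdot> H)) = Dom X R"
      using b e R(1-3) H(1-3) by simp_all
    have "bsum X ?T (R \<cdot> \<iota>) (descent \<cdot> H) \<cdot> R = bsum X V ((R \<cdot> \<iota>) \<cdot> R) ((descent \<cdot> H) \<cdot> R)"
      by (rule bsum_vertical_connection[OF vc]) (use e R(1-3) H(1-3) in simp_all)
    also have "\<dots> = bsum X V R (tp X E \<cdot> zero V)"
      using R(1-4) H(1-4) extend_right[OF descent_proj(1), of "zero V"] by simp
    also have "\<dots> = R"
      by (rule bsum_zero(1)[OF V_additive]) (use R in simp_all)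
    finally show "bsum X ?T (R \<cdot> \<iota>) (descent \<cdot> H) \<cdot> R = Ident X (Tob X E) \<cdot> R"
      using R(1,2) by simp
    have "bsum X ?T (R \<cdot> \<iota>) (descent \<cdot> H) \<cdot> Tar X q =
        bsum X (tangent_bundle X M) ((R \<cdot> \<iota>) \<cdot> Tar X q) ((descent \<cdot> H) \<cdot> Tar X q)"
      using tangent_bsum_comp_Tar[of q "R \<cdot> \<iota>" "descent \<cdot> H"] e R(1-3) H(1-3) by simp
    also have "\<dots> = bsum X (tangent_bundle X M) ((Tar X q \<cdot> tp X M) \<cdot> tz X M) (Tar X q)"
      using R(1-3) H(1-3,5) extend_right[OF vertical_connection_tV[OF vc], of "tz X M"]
      by (simp add: iota_Tq descent_proj)
    also have "\<dots> = Tar X q"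
      using bsum_zero(2)[OF tp_additive[of M], of "Tar X q" "Tar X q \<cdot> tp X M"] by simp
    finally show "bsum X ?T (R \<cdot> \<iota>) (descent \<cdot> H) \<cdot> Tar X q = Ident X (Tob X E) \<cdot> Tar X q"
      by simp
  qed (use R in simp_all)
  ultimately have "ehresmann_connection X q V \<iota> F tF R H"
    using vc H Hp
    by (simp add: ehresmann_connection_def horizontal_connection_def linear_over_def
        linear_morphism_def bundle_morphism_def hom_iff)
  then show ?thesis using that by blast
qed

text \<open>Conversely a tangent vector is the sum of its vertical and horizontal parts, so the arrow with
  coordinates \<open>u\<close> in \<open>Vq\<close> and \<open>v\<close> in \<open>TM\<close> can only be \<open>u \<iota>\<^sub>q + \<langle>u q\<^sup>V, v\<rangle> H\<close>.\<close>

lemma ehresmann_imp_full: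
  assumes "ehresmann_connection X q V \<iota> F tF R H"
  shows "full_vertical_connection X q V \<iota> tV R"
proof -
  let ?T = "tangent_bundle X E"
  have vc: "vertical_connection X q V \<iota> R"
    and H: "H \<in> Arr X" "Dom X H = Dom X tF" "Cod X H = Tob X E" "H \<cdot> R = proj F \<cdot> zero V"
      "H \<cdot> descent = Ident X (Dom X tF)" "H \<cdot> tp X E = proj F"
      "bsum X ?T (R \<cdot> \<iota>) (descent \<cdot> H) = Ident X (Tob X E)"
    using assms
    by (auto simp: ehresmann_connection_def horizontal_connection_def linear_over_def
        linear_morphism_def bundle_morphism_def hom_iff)
  note R = vertical_connectionD[OF vc]
  have Hq: "H \<cdot> Tar X q = tF"
    using extend_right[OF H(5), of tF] H(1-3) by (simp add: descent_proj)
  have e: "(R \<cdot> \<iota>) \<cdot> tp X E = (descent \<cdot> H) \<cdot> tp X E"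
    using R H by (simp add: descent_proj proj_V)
  have "is_pullback X R (Tar X q) tV (tp X M)"
  proof (rule is_pullbackI)
    show "R \<cdot> tV = Tar X q \<cdot> tp X M" by (rule vertical_connection_tV[OF vc])
    fix u v
    assume uv: "u \<in> Arr X" "v \<in> Arr X" "Dom X v = Dom X u" "Cod X u = Dom X tV"
      "Cod X v = Dom X (tp X M)" "u \<cdot> tV = v \<cdot> tp X M"
    have uv': "Cod X u = Dom X \<iota>" "Cod X v = Tob X M" using uv by simp_all
    have "(u \<cdot> proj V) \<cdot> q = v \<cdot> tp X M" using uv uv' by (simp add: proj_V_q)
    then obtain h where h: "h \<in> Arr X" "Dom X h = Dom X u" "Cod X h = Dom X tF"
      "h \<cdot> proj F = u \<cdot> proj V" "h \<cdot> tF = v"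
      using pair[OF tangent_pullback_0[OF F_pullback], of "u \<cdot> proj V" v] uv uv' by simp
    define w where "w = bsum X ?T (u \<cdot> \<iota>) (h \<cdot> H)"
    have e': "(u \<cdot> \<iota>) \<cdot> tp X E = (h \<cdot> H) \<cdot> tp X E"
      using h uv uv' H by (simp add: proj_V)
    have w: "w \<in> Arr X" "Dom X w = Dom X u" "Cod X w = Tob X E"
      using bsum[of ?T "u \<cdot> \<iota>" "h \<cdot> H"] e' h uv uv' H(1-3) by (simp_all add: w_def)
    have "w \<cdot> R = bsum X V ((u \<cdot> \<iota>) \<cdot> R) ((h \<cdot> H) \<cdot> R)"
      unfolding w_def by (rule bsum_vertical_connection[OF vc]) (use e' h uv uv' H(1-3) in simp_all)
    also have "\<dots> = bsum X V u ((u \<cdot> proj V) \<cdot> zero V)"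
      using R(1-4) H(1-4) h uv uv' extend_right[OF h(4), of "zero V"] by simp
    also have "\<dots> = u"
      by (rule bsum_zero(1)[OF V_additive]) (use uv uv' in simp_all)
    finally have wR: "w \<cdot> R = u" .
    have "w \<cdot> Tar X q = bsum X (tangent_bundle X M) ((u \<cdot> \<iota>) \<cdot> Tar X q) ((h \<cdot> H) \<cdot> Tar X q)"
      unfolding w_def using tangent_bsum_comp_Tar[of q "u \<cdot> \<iota>" "h \<cdot> H"] e' h uv uv' H(1-3) by simp
    also have "\<dots> = bsum X (tangent_bundle X M) ((v \<cdot> tp X M) \<cdot> tz X M) v"
      using extend_right[OF uv(6), of "tz X M"] h uv(1-3) uv' H(1-3) Hq by (simp add: iota_Tq)
    also have "\<dots> = v"
      using bsum_zero(2)[OF tp_additive[of M], of v "v \<cdot> tp X M"] uv uv' by simp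
    finally have wq: "w \<cdot> Tar X q = v" .
    show "\<exists>w. w \<in> Arr X \<and> Dom X w = Dom X u \<and> Cod X w = Dom X R \<and> w \<cdot> R = u \<and> w \<cdot> Tar X q = v"
      using w wR wq R(2) by auto
  next
    fix w w'
    assume w: "w \<in> Arr X" "w' \<in> Arr X" "Dom X w = Dom X w'" "Cod X w = Dom X R"
      "Cod X w' = Dom X R" "w \<cdot> R = w' \<cdot> R" "w \<cdot> Tar X q = w' \<cdot> Tar X q"
    have c: "Cod X w = Tob X E" "Cod X w' = Tob X E" using w R(2) by simp_all
    have split: "x = bsum X ?T ((x \<cdot> R) \<cdot> \<iota>) ((x \<cdot> descent) \<cdot> H)"
      if "x \<in> Arr X" "Cod X x = Tob X E" for x
    proof -
      have "x \<cdot> bsum X ?T (R \<cdot> \<iota>) (descent \<cdot> H) = bsum X ?T (x \<cdot> (R \<cdot> \<iota>)) (x \<cdot> (descent \<cdot> H))"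
        by (rule comp_bsum) (use that e R(1-3) H(1-3) in simp_all)
      then show ?thesis using that R(1-3) H by simp
    qed
    have p: "w \<cdot> tp X E = w' \<cdot> tp X E"
      using extend_right[OF w(6), of "proj V"] w(1,2) c R by simp
    have "w \<cdot> descent = w' \<cdot> descent"
      by (rule pullback_ext[OF tangent_pullback_0[OF F_pullback]])
        (use w(1-3,7) c p in \<open>simp_all add: descent_proj\<close>)
    then show "w = w'"
      using split[OF w(1) c(1)] split[OF w(2) c(2)] w(6) by metis
  qed (use R in simp_all)
  \<comment> \<open>A tangent pullback of \<open>T\<^sup>Vq\<close> along \<open>p\<^sub>M\<close> is a tangent pullback of \<open>Tq\<close> along \<open>p\<^sub>M z\<^sub>M\<close>, by pasting
    with the square defining \<open>Vq\<close>; the latter exists as \<open>q\<close> is a display map.\<close>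
  moreover obtain a b where ab: "tangent_pullback X a b (Tar X q) (tp X M \<cdot> tz X M)"
    using display_pullback_T[OF q_display, of "tp X M \<cdot> tz X M"] by auto
  moreover have "tangent_pullback X (pair X \<iota> tV a (b \<cdot> tp X M)) b tV (tp X M)"
  proof -
    note t = is_pullbackD[OF tangent_pullback_0[OF ab]]
    have a: "a \<cdot> Tar X q = (b \<cdot> tp X M) \<cdot> tz X M" using t by simp
    note p = pair[OF tangent_pullback_0[OF V_pullback] _ _ _ _ _ a]
    show ?thesis
      using tangent_pullback_paste_iff[OF V_pullback, of "pair X \<iota> tV a (b \<cdot> tp X M)" b "tp X M"]
        p t ab by simp
  qed
  ultimately have "tangent_pullback X R (Tar X q) tV (tp X M)"
    using tangent_pullback_unique by blast
  then show ?thesis using vc by (simp add: full_vertical_connection_def)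
qed

lemma full_iff_ehresmann:
  "full_vertical_connection X q V \<iota> tV R \<longleftrightarrow>
    vertical_connection X q V \<iota> R \<and> (\<exists>H. ehresmann_connection X q V \<iota> F tF R H)"
  using full_imp_ehresmann[of R] ehresmann_imp_full[of R]
  unfolding full_vertical_connection_def by blast

end

theorem theorem3p39:
  fixes X :: "('o, 'm) tangent_data" and E M :: 'o and q \<phi> \<iota> tV tF :: 'm
    and V F :: "'m bundle_data"
  assumes "tangent_category X"
    and "q \<in> hom X E M"
    and "tangent_display_map X q"
    and "vertical_bundle X q V \<iota> tV"
    and "tangent_display_map X (proj V)"
    and "finsler_bundle X q F tF"
    and "\<phi> \<in> hom X (Tob X E) (Tob X E)"
  shows
    "(split_abstract_vertical_connection X q \<phi> \<longleftrightarrow>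
       (\<exists>R. full_vertical_connection X q V \<iota> tV R \<and> vertical_connection_form X \<iota> R = \<phi>)) \<and>
     (split_abstract_vertical_connection X q \<phi> \<longleftrightarrow>
       (\<exists>R. vertical_connection X q V \<iota> R \<and>
          (\<exists>H. ehresmann_connection X q V \<iota> F tF R H) \<and>
          vertical_connection_form X \<iota> R = \<phi>))"
proof -
  interpret tangent_category X by fact
  interpret connection_setting X q \<iota> tV E M V F tF
    by unfold_locales (use assms in blast)+
  show ?thesis
    unfolding split_abstract_iff_full full_iff_ehresmann by blast
qed

end
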